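(* Let $\Gamma$ be the quiver of type $A_\infty$ with vertex set $I=\mathbb{Z}$. Let $\Lambda=\sum_{i\in I}\lambda_i\cdot i\in\mathbb{N}[I]$, let $\nu\in\mathbb{N}[I]$ with $|\nu|=m$, let $\mathbf{i}=i_1\cdots i_m\in \mathrm{Seq}(\nu)$, and let $1\le r\le m$. Then the nilpotency degree of $x_{r,\mathbf{i}}$ in the cyclotomic quotient $R_\nu^\Lambda$ is less than or equal to the $r$-antigravity bound $$b_r=b_r(\mathbf{i})=\sum_{j\in \mathrm{Supp}(a_r(\mathbf{i}))}\lambda_j ,$$ that is, $x_{r,\mathbf{i}}^{\,b_r}=0$ in $R_\nu^\Lambda$.
   Context: **Cartan form.** $I=\mathbb{Z}$; $i\cdot i=2$, $i\cdot j=-1$ if $|i-j|=1$, and $i\cdot j=0$ otherwise. $\mathbb{N}[I]$ is the set of finite formal sums $\nu=\sum_i\nu_i\cdot i$ with $\nu_i\in\mathbb{N}=\{0,1,2,\dots\}$; $|\nu|=\sum_i\nu_i$. $\mathrm{Seq}(\nu)$ is the set of sequences $\mathbf{i}=i_1\cdots i_m\in I^m$ ($m=|\nu|$) in which each $i$ appears exactly $\nu_i$ times. $s_r\mathbf{i}$ denotes $\mathbf{i}$ with entries $r$ and $r+1$ exchanged. **The ring $R(\nu)$.** Over a field $\Bbbk$, $R(\nu)$ is the $\Bbbk$-algebra generated by $1_{\mathbf{i}}$, $x_{r,\mathbf{i}}$ ($1\le r\le m$), $\delta_{r,\mathbf{i}}$ ($1\le r<m$), for $\mathbf{i}\in\mathrm{Seq}(\nu)$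 (vertical strands coloured by $\mathbf{i}$, a dot on strand $r$, a crossing of strands $r,r+1$; in a product $ab$ the diagram $a$ is placed on top of $b$), with relations: (1) the $1_{\mathbf{i}}$ are orthogonal idempotents with sum $1$; $x_{r,\mathbf{i}}=1_{\mathbf{i}}x_{r,\mathbf{i}}1_{\mathbf{i}}$; $\delta_{r,\mathbf{i}}=1_{s_r\mathbf{i}}\,\delta_{r,\mathbf{i}}\,1_{\mathbf{i}}$; (2) $x_{r,\mathbf{i}}x_{t,\mathbf{i}}=x_{t,\mathbf{i}}x_{r,\mathbf{i}}$; $\delta_{r,\mathbf{i}}x_{t,\mathbf{i}}=x_{t,s_r\mathbf{i}}\delta_{r,\mathbf{i}}$ if $t\ne r,r+1$; $\delta_{r,s_t\mathbf{i}}\delta_{t,\mathbf{i}}=\delta_{t,s_r\mathbf{i}}\delta_{r,\mathbf{i}}$ if $|r-t|>1$; (3) $\delta_{r,s_r\mathbf{i}}\delta_{r,\mathbf{i}}$ equals $0$ if $i_r=i_{r+1}$, equals $1_{\mathbf{i}}$ if $i_r\cdot i_{r+1}=0$, and equals $x_{r,\mathbf{i}}+x_{r+1,\mathbf{i}}$ if $i_r\cdot i_{r+1}=-1$; (4) if $i_r\neq i_{r+1}$: $x_{r,s_r\mathbf{i}}\delta_{r,\mathbf{i}}=\delta_{r,\mathbf{i}}x_{r+1,\mathbf{i}}$ and $x_{r+1,s_r\mathbf{i}}\delta_{r,\mathbf{i}}=\delta_{r,\mathbf{i}}x_{r,\mathbf{i}}$; (5) if $i_r=i_{r+1}$: $x_{r,\mathbf{i}}\delta_{r,\mathbf{i}}-\delta_{r,\mathbf{i}}x_{r+1,\mathbf{i}}=1_{\mathbf{i}}$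 and $\delta_{r,\mathbf{i}}x_{r,\mathbf{i}}-x_{r+1,\mathbf{i}}\delta_{r,\mathbf{i}}=1_{\mathbf{i}}$; (6) (omitting the evident sequence subscripts) $(\delta_r\delta_{r+1}\delta_r-\delta_{r+1}\delta_r\delta_{r+1})1_{\mathbf{i}}$ equals $1_{\mathbf{i}}$ if $i_r=i_{r+2}$ and $i_r\cdot i_{r+1}=-1$, and equals $0$ otherwise. **Cyclotomic quotient.** For $\Lambda=\sum_i\lambda_i\cdot i\in\mathbb{N}[I]$, $R_\nu^\Lambda=R(\nu)/\mathcal{J}_\Lambda$, where $\mathcal{J}_\Lambda$ is the two-sided ideal generated by $x_{1,\mathbf{i}}^{\lambda_{i_1}}$ for all $\mathbf{i}\in\mathrm{Seq}(\nu)$. Convention: $x_{r,\mathbf{i}}^0=1_{\mathbf{i}}$. The nilpotency degree of $x_{r,\mathbf{i}}$ is the least $d\ge0$ with $x_{r,\mathbf{i}}^d=0$. **Antigravity.** Place beads $1,\dots,m$ successively on an abacus with runners indexed by $I$, bead $k$ on runner $i_k$; beads on equal or adjacent runners block one another. The resulting unlabelled configuration is $\mathrm{conf}(\mathbf{i})$. Anchor bead $r$ and let all beads not trapped below it be pulled off upwards. Bead $k$ remains (is trapped) exactly when $k=r$ or there is a chain $k=k_0<k_1<\dots<k_t=r$ with $|i_{k_s}-i_{k_{s+1}}|\le1$ for all $s$. The remaining beads form the antigravity configuration of $\mathbf{i}$ with anchor $i_r$. The $r$-stable configuration $a_r(\mathbf{i})$ is obtained from it by deleting beads by "antigravity moves",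 which never change the set of occupied runners, until exactly one bead remains on each occupied runner. Hence $\mathrm{Supp}(a_r(\mathbf{i}))$, the set of runners occupied in $a_r(\mathbf{i})$, equals $\{i_k : \text{bead } k \text{ remains when bead } r \text{ is anchored}\}$. *)

theory Defs
  imports "HOL-Library.Multiset" "HOL-Library.Poly_Mapping" "HOL-Algebra.Algebra"
begin

text \<open>
  Noncommutative monomials, i.e. words, written as a (noncommutative) additive monoid: then
  \<open>'g monomial \<Rightarrow>\<^sub>0 'k\<close> carries the convolution product of \<open>Poly_Mapping\<close> and is the free
  associative unital algebra over \<open>'k\<close> on the type \<open>'g\<close>.
\<close>

datatype 'g monomial = Monomial (letters: "'g list")

instantiation monomial :: (type) monoid_add
begin

definition zero_monomial :: "'a monomial"
  where "0 = Monomial []"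

definition plus_monomial :: "'a monomial \<Rightarrow> 'a monomial \<Rightarrow> 'a monomial"
  where "u + v = Monomial (letters u @ letters v)"

instance
  by standard (simp_all add: zero_monomial_def plus_monomial_def)

end

definition free_algebra :: "'g set \<Rightarrow> ('g monomial \<Rightarrow>\<^sub>0 'k::field) ring"
  where "free_algebra G =
    \<lparr>carrier = {f. \<forall>w\<in>Poly_Mapping.keys f. set (letters w) \<subseteq> G},
     monoid.mult = (*), one = 1, ring.zero = 0, ring.add = (+)\<rparr>"

definition var :: "'g \<Rightarrow> ('g monomial \<Rightarrow>\<^sub>0 'k::field)"
  where "var g = Poly_Mapping.single (Monomial [g]) 1"

lemma free_algebra_simps [simp]:
  "a \<in> carrier (free_algebra G) \<longleftrightarrow> (\<forall>w\<in>Poly_Mapping.keys a. set (letters w) \<subseteq> G)"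
  "a \<otimes>\<^bsub>free_algebra G\<^esub> b = a * b"
  "a \<oplus>\<^bsub>free_algebra G\<^esub> b = a + b"
  "\<one>\<^bsub>free_algebra G\<^esub> = 1"
  "\<zero>\<^bsub>free_algebra G\<^esub> = 0"
  by (simp_all add: free_algebra_def)

lemma free_algebra_closed:
  shows "a \<in> carrier (free_algebra G) \<Longrightarrow> b \<in> carrier (free_algebra G)
      \<Longrightarrow> a + b \<in> carrier (free_algebra G)"
    and "a \<in> carrier (free_algebra G) \<Longrightarrow> b \<in> carrier (free_algebra G)
      \<Longrightarrow> a - b \<in> carrier (free_algebra G)"
    and "a \<in> carrier (free_algebra G) \<Longrightarrow> b \<in> carrier (free_algebra G)
      \<Longrightarrow> a * b \<in> carrier (free_algebra G)"
    and "- a \<in> carrier (free_algebra G) \<longleftrightarrow> a \<in> carrier (free_algebra G)"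
    and "0 \<in> carrier (free_algebra G)" "1 \<in> carrier (free_algebra G)"
    and "g \<in> G \<Longrightarrow> var g \<in> carrier (free_algebra G)"
proof -
  show "a \<in> carrier (free_algebra G) \<Longrightarrow> b \<in> carrier (free_algebra G)
      \<Longrightarrow> a + b \<in> carrier (free_algebra G)"
    using keys_add[of a b] by auto
  show "a \<in> carrier (free_algebra G) \<Longrightarrow> b \<in> carrier (free_algebra G)
      \<Longrightarrow> a - b \<in> carrier (free_algebra G)"
    using keys_diff[of a b] by auto
  show "a \<in> carrier (free_algebra G) \<Longrightarrow> b \<in> carrier (free_algebra G)
      \<Longrightarrow> a * b \<in> carrier (free_algebra G)"
    using keys_mult[of a b] by (fastforce simp: plus_monomial_def)
qed (auto simp: var_def zero_monomial_def)

lemma free_algebra_sum_closed: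
  assumes "\<And>i. i \<in> A \<Longrightarrow> f i \<in> carrier (free_algebra G)"
  shows "sum f A \<in> carrier (free_algebra G)"
  using assms
  by (induction A rule: infinite_finite_induct)
    (metis sum.infinite free_algebra_closed(5), metis sum.empty free_algebra_closed(5),
     metis sum.insert free_algebra_closed(1) insertCI)

lemma ring_free_algebra: "ring (free_algebra G :: ('g monomial \<Rightarrow>\<^sub>0 'k::field) ring)"
proof (rule ringI)
  let ?F = "free_algebra G :: ('g monomial \<Rightarrow>\<^sub>0 'k::field) ring"
  show "abelian_group ?F"
  proof (rule abelian_groupI)
    fix x assume "x \<in> carrier ?F"
    then show "\<exists>y\<in>carrier ?F. y \<oplus>\<^bsub>?F\<^esub> x = \<zero>\<^bsub>?F\<^esub>"
      by (intro bexI[of _ "- x"]) (simp_all add: free_algebra_closed(4) del: free_algebra_simps(1))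
  qed (simp_all add: free_algebra_closed add_ac del: free_algebra_simps(1))
  show "Group.monoid ?F"
    by (rule monoidI) (simp_all add: free_algebra_closed mult.assoc del: free_algebra_simps(1))
qed (simp_all add: algebra_simps)

text \<open>
  The vertex set is \<^typ>\<open>int\<close>, and elements of \<open>\<nat>[I]\<close> are multisets of integers:
  \<open>count \<nu> i\<close> is \<open>\<nu>\<^sub>i\<close> and \<open>size \<nu>\<close> is \<open>|\<nu>|\<close>.
\<close>

definition cartan :: "int \<Rightarrow> int \<Rightarrow> int"
  where "cartan i j = (if i = j then 2 else if \<bar>i - j\<bar> = 1 then - 1 else 0)"

definition Seq :: "int multiset \<Rightarrow> int list set"
  where "Seq \<nu> = {is. \<forall>i. count (mset is) i = count \<nu> i}"

text \<open>Positions in a sequence are numbered from 1.\<close>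

definition col :: "int list \<Rightarrow> nat \<Rightarrow> int"
  where "col is r = is ! (r - 1)"

definition swp :: "nat \<Rightarrow> int list \<Rightarrow> int list"
  where "swp r is = is[r - 1 := col is (r + 1), r := col is r]"

lemma Seq_iff: "is \<in> Seq \<nu> \<longleftrightarrow> mset is = \<nu>"
  by (auto simp: Seq_def multiset_eq_iff)

lemma length_Seq: "is \<in> Seq \<nu> \<Longrightarrow> length is = size \<nu>"
  by (auto simp: Seq_iff)

lemma finite_Seq: "finite (Seq \<nu>)"
  by (rule finite_subset[of _ "{xs. set xs \<subseteq> set_mset \<nu> \<and> length xs = size \<nu>}"])
    (auto simp: Seq_iff finite_lists_length_eq)

lemma swp_Seq: "is \<in> Seq \<nu> \<Longrightarrow> 1 \<le> r \<Longrightarrow> r < size \<nu> \<Longrightarrow> swp r is \<in> Seq \<nu>"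
  by (auto simp: Seq_iff swp_def col_def mset_swap)

datatype klr_gen =
    Idemp "int list"
  | Dot nat "int list"
  | Crossing nat "int list"

definition klr_gens :: "int multiset \<Rightarrow> klr_gen set"
  where "klr_gens \<nu> =
    {Idemp is | is. is \<in> Seq \<nu>} \<union>
    {Dot r is | r is. is \<in> Seq \<nu> \<and> 1 \<le> r \<and> r \<le> size \<nu>} \<union>
    {Crossing r is | r is. is \<in> Seq \<nu> \<and> 1 \<le> r \<and> r < size \<nu>}"

type_synonym 'k klr_free = "klr_gen monomial \<Rightarrow>\<^sub>0 'k"

abbreviation e_gen :: "int list \<Rightarrow> 'k::field klr_free" where "e_gen is \<equiv> var (Idemp is)"
abbreviation x_gen :: "nat \<Rightarrow> int list \<Rightarrow> 'k::field klr_free" where "x_gen r is \<equiv> var (Dot r is)"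
abbreviation d_gen :: "nat \<Rightarrow> int list \<Rightarrow> 'k::field klr_free" where "d_gen r is \<equiv> var (Crossing r is)"

text \<open>\<open>klr_rel \<nu> a b\<close>: the equation \<open>a = b\<close> is one of the defining relations of \<open>R(\<nu>)\<close>.
  In a product \<open>a * b\<close> the diagram \<open>a\<close> is on top of \<open>b\<close>, so the rightmost factor meets the
  bottom sequence first.\<close>

inductive klr_rel :: "int multiset \<Rightarrow> 'k::field klr_free \<Rightarrow> 'k klr_free \<Rightarrow> bool"
  for \<nu> :: "int multiset"
  where
    idem: "is \<in> Seq \<nu> \<Longrightarrow> klr_rel \<nu> (e_gen is * e_gen is) (e_gen is)"
  | orth: "is \<in> Seq \<nu> \<Longrightarrow> js \<in> Seq \<nu> \<Longrightarrow> is \<noteq> js \<Longrightarrow> klr_rel \<nu> (e_gen is * e_gen js) 0"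
  | sum_idem: "klr_rel \<nu> (\<Sum>is\<in>Seq \<nu>. e_gen is) 1"
  | dot_idem: "is \<in> Seq \<nu> \<Longrightarrow> 1 \<le> r \<Longrightarrow> r \<le> size \<nu> \<Longrightarrow>
      klr_rel \<nu> (x_gen r is) (e_gen is * x_gen r is * e_gen is)"
  | cross_idem: "is \<in> Seq \<nu> \<Longrightarrow> 1 \<le> r \<Longrightarrow> r < size \<nu> \<Longrightarrow>
      klr_rel \<nu> (d_gen r is) (e_gen (swp r is) * d_gen r is * e_gen is)"
  | dot_dot: "is \<in> Seq \<nu> \<Longrightarrow> 1 \<le> r \<Longrightarrow> r \<le> size \<nu> \<Longrightarrow> 1 \<le> t \<Longrightarrow> t \<le> size \<nu> \<Longrightarrow>
      klr_rel \<nu> (x_gen r is * x_gen t is) (x_gen t is * x_gen r is)"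
  | cross_dot_far: "is \<in> Seq \<nu> \<Longrightarrow> 1 \<le> r \<Longrightarrow> r < size \<nu> \<Longrightarrow> 1 \<le> t \<Longrightarrow> t \<le> size \<nu> \<Longrightarrow>
      t \<noteq> r \<Longrightarrow> t \<noteq> r + 1 \<Longrightarrow>
      klr_rel \<nu> (d_gen r is * x_gen t is) (x_gen t (swp r is) * d_gen r is)"
  | cross_cross_far: "is \<in> Seq \<nu> \<Longrightarrow> 1 \<le> r \<Longrightarrow> r < size \<nu> \<Longrightarrow> 1 \<le> t \<Longrightarrow> t < size \<nu> \<Longrightarrow>
      \<bar>int r - int t\<bar> > 1 \<Longrightarrow>
      klr_rel \<nu> (d_gen r (swp t is) * d_gen t is) (d_gen t (swp r is) * d_gen r is)"
  | cross_cross_same: "is \<in> Seq \<nu> \<Longrightarrow> 1 \<le> r \<Longrightarrow> r < size \<nu> \<Longrightarrow> col is r = col is (r + 1) \<Longrightarrow>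
      klr_rel \<nu> (d_gen r (swp r is) * d_gen r is) 0"
  | cross_cross_distant: "is \<in> Seq \<nu> \<Longrightarrow> 1 \<le> r \<Longrightarrow> r < size \<nu> \<Longrightarrow>
      cartan (col is r) (col is (r + 1)) = 0 \<Longrightarrow>
      klr_rel \<nu> (d_gen r (swp r is) * d_gen r is) (e_gen is)"
  | cross_cross_adjacent: "is \<in> Seq \<nu> \<Longrightarrow> 1 \<le> r \<Longrightarrow> r < size \<nu> \<Longrightarrow>
      cartan (col is r) (col is (r + 1)) = - 1 \<Longrightarrow>
      klr_rel \<nu> (d_gen r (swp r is) * d_gen r is) (x_gen r is + x_gen (r + 1) is)"
  | slide_left: "is \<in> Seq \<nu> \<Longrightarrow> 1 \<le> r \<Longrightarrow> r < size \<nu> \<Longrightarrow> col is r \<noteq> col is (r + 1) \<Longrightarrow>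
      klr_rel \<nu> (x_gen r (swp r is) * d_gen r is) (d_gen r is * x_gen (r + 1) is)"
  | slide_right: "is \<in> Seq \<nu> \<Longrightarrow> 1 \<le> r \<Longrightarrow> r < size \<nu> \<Longrightarrow> col is r \<noteq> col is (r + 1) \<Longrightarrow>
      klr_rel \<nu> (x_gen (r + 1) (swp r is) * d_gen r is) (d_gen r is * x_gen r is)"
  | nil_left: "is \<in> Seq \<nu> \<Longrightarrow> 1 \<le> r \<Longrightarrow> r < size \<nu> \<Longrightarrow> col is r = col is (r + 1) \<Longrightarrow>
      klr_rel \<nu> (x_gen r is * d_gen r is - d_gen r is * x_gen (r + 1) is) (e_gen is)"
  | nil_right: "is \<in> Seq \<nu> \<Longrightarrow> 1 \<le> r \<Longrightarrow> r < size \<nu> \<Longrightarrow> col is r = col is (r + 1) \<Longrightarrow>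
      klr_rel \<nu> (d_gen r is * x_gen r is - x_gen (r + 1) is * d_gen r is) (e_gen is)"
  | braid: "is \<in> Seq \<nu> \<Longrightarrow> 1 \<le> r \<Longrightarrow> r + 1 < size \<nu> \<Longrightarrow>
      klr_rel \<nu>
        (d_gen r (swp (r + 1) (swp r is)) * d_gen (r + 1) (swp r is) * d_gen r is
         - d_gen (r + 1) (swp r (swp (r + 1) is)) * d_gen r (swp (r + 1) is) * d_gen (r + 1) is)
        (if col is r = col is (r + 2) \<and> cartan (col is r) (col is (r + 1)) = - 1
         then e_gen is else 0)"

definition klr_relators :: "int multiset \<Rightarrow> 'k::field klr_free set"
  where "klr_relators \<nu> = {a - b | a b. klr_rel \<nu> a b}"

text \<open>
  The ideal below contains the image of a relator under every scalar because the free algebra is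
  unital, so this ring quotient is the quotient of \<open>'k\<close>-algebras.
\<close>

definition klr_ideal :: "int multiset \<Rightarrow> 'k::field klr_free set"
  where "klr_ideal \<nu> = genideal (free_algebra (klr_gens \<nu>)) (klr_relators \<nu>)"

definition klr :: "int multiset \<Rightarrow> 'k::field klr_free set ring"
  where "klr \<nu> = free_algebra (klr_gens \<nu>) Quot klr_ideal \<nu>"

definition klr_e :: "int multiset \<Rightarrow> int list \<Rightarrow> 'k::field klr_free set"
  where "klr_e \<nu> is = klr_ideal \<nu> +>\<^bsub>free_algebra (klr_gens \<nu>)\<^esub> e_gen is"

definition klr_x :: "int multiset \<Rightarrow> nat \<Rightarrow> int list \<Rightarrow> 'k::field klr_free set"
  where "klr_x \<nu> r is = klr_ideal \<nu> +>\<^bsub>free_algebra (klr_gens \<nu>)\<^esub> x_gen r is"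

text \<open>
  \<open>genideal\<close> is meaningful only for subsets of the carrier; the next lemma and
  \<open>cyc_gens_subset\<close> below ensure this.
\<close>

lemma klr_gens_intros:
  "is \<in> Seq \<nu> \<Longrightarrow> Idemp is \<in> klr_gens \<nu>"
  "is \<in> Seq \<nu> \<Longrightarrow> 1 \<le> r \<Longrightarrow> r \<le> size \<nu> \<Longrightarrow> Dot r is \<in> klr_gens \<nu>"
  "is \<in> Seq \<nu> \<Longrightarrow> 1 \<le> r \<Longrightarrow> r < size \<nu> \<Longrightarrow> Crossing r is \<in> klr_gens \<nu>"
  by (auto simp: klr_gens_def)

lemma klr_relators_subset:
  "(klr_relators \<nu> :: 'k::field klr_free set) \<subseteq> carrier (free_algebra (klr_gens \<nu>))"
proof -
  let ?F = "free_algebra (klr_gens \<nu>) :: 'k klr_free ring"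
  have "a \<in> carrier ?F \<and> b \<in> carrier ?F" if "klr_rel \<nu> a b" for a b :: "'k klr_free"
    using that
    by cases
      (simp_all add: free_algebra_closed free_algebra_sum_closed klr_gens_intros swp_Seq
         del: free_algebra_simps(1))
  then show ?thesis
    by (auto simp: klr_relators_def simp del: free_algebra_simps(1) intro!: free_algebra_closed(2))
qed

lemma ideal_klr_ideal:
  "ideal (klr_ideal \<nu> :: 'k::field klr_free set) (free_algebra (klr_gens \<nu>))"
  unfolding klr_ideal_def
  by (rule ring.genideal_ideal[OF ring_free_algebra klr_relators_subset])

lemma ring_klr: "ring (klr \<nu> :: 'k::field klr_free set ring)"
  unfolding klr_def by (rule ideal.quotient_is_ring[OF ideal_klr_ideal])

text \<open>Powers of an element \<open>x = e x e\<close> in the corner \<open>e R e\<close>, whose unit is \<open>e\<close>.\<close>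

definition corner_pow :: "('a, 'b) ring_scheme \<Rightarrow> 'a \<Rightarrow> 'a \<Rightarrow> nat \<Rightarrow> 'a"
  where "corner_pow R e x d = (if d = 0 then e else x [^]\<^bsub>R\<^esub> d)"

text \<open>Unspecified if \<open>x\<close> is not nilpotent, as \<open>LEAST\<close> always is on an empty range.\<close>

definition nilpotency_degree :: "('a, 'b) ring_scheme \<Rightarrow> 'a \<Rightarrow> 'a \<Rightarrow> nat"
  where "nilpotency_degree R e x = (LEAST d. corner_pow R e x d = \<zero>\<^bsub>R\<^esub>)"

text \<open>For \<open>\<nu> = 0\<close> there is no first strand, hence no generator.\<close>

definition cyc_gens :: "int multiset \<Rightarrow> int multiset \<Rightarrow> 'k::field klr_free set set"
  where "cyc_gens \<Lambda> \<nu> =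
    {corner_pow (klr \<nu>) (klr_e \<nu> is) (klr_x \<nu> 1 is) (count \<Lambda> (col is 1))
      | is. is \<in> Seq \<nu> \<and> is \<noteq> []}"

definition cyc_ideal :: "int multiset \<Rightarrow> int multiset \<Rightarrow> 'k::field klr_free set set"
  where "cyc_ideal \<Lambda> \<nu> = genideal (klr \<nu>) (cyc_gens \<Lambda> \<nu>)"

definition cyc_klr :: "int multiset \<Rightarrow> int multiset \<Rightarrow> 'k::field klr_free set set ring"
  where "cyc_klr \<Lambda> \<nu> = klr \<nu> Quot cyc_ideal \<Lambda> \<nu>"

definition cyc_e :: "int multiset \<Rightarrow> int multiset \<Rightarrow> int list \<Rightarrow> 'k::field klr_free set set"
  where "cyc_e \<Lambda> \<nu> is = cyc_ideal \<Lambda> \<nu> +>\<^bsub>klr \<nu>\<^esub> klr_e \<nu> is"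

definition cyc_x :: "int multiset \<Rightarrow> int multiset \<Rightarrow> nat \<Rightarrow> int list \<Rightarrow> 'k::field klr_free set set"
  where "cyc_x \<Lambda> \<nu> r is = cyc_ideal \<Lambda> \<nu> +>\<^bsub>klr \<nu>\<^esub> klr_x \<nu> r is"

lemma klr_e_carrier:
  assumes "is \<in> Seq \<nu>"
  shows "(klr_e \<nu> is :: 'k::field klr_free set) \<in> carrier (klr \<nu>)"
  using free_algebra_closed(7)[OF klr_gens_intros(1)[OF assms]]
  unfolding klr_def klr_e_def FactRing_simps by (auto simp del: free_algebra_simps(1))

lemma klr_x_carrier:
  assumes "is \<in> Seq \<nu>" "1 \<le> r" "r \<le> size \<nu>"
  shows "(klr_x \<nu> r is :: 'k::field klr_free set) \<in> carrier (klr \<nu>)"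
  using free_algebra_closed(7)[OF klr_gens_intros(2)[OF assms]]
  unfolding klr_def klr_x_def FactRing_simps by (auto simp del: free_algebra_simps(1))

lemma cyc_gens_subset: "(cyc_gens \<Lambda> \<nu> :: 'k::field klr_free set set) \<subseteq> carrier (klr \<nu>)"
proof -
  interpret ring "klr \<nu> :: 'k klr_free set ring" by (rule ring_klr)
  have "1 \<le> size \<nu>" if "is \<in> Seq \<nu>" "is \<noteq> []" for "is"
    using that by (cases "is") (auto simp: Seq_iff)
  then show ?thesis
    by (auto simp: cyc_gens_def corner_pow_def klr_e_carrier klr_x_carrier)
qed

lemma ideal_cyc_ideal: "ideal (cyc_ideal \<Lambda> \<nu> :: 'k::field klr_free set set) (klr \<nu>)"
  unfolding cyc_ideal_def by (rule ring.genideal_ideal[OF ring_klr cyc_gens_subset])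

lemma ring_cyc_klr: "ring (cyc_klr \<Lambda> \<nu> :: 'k::field klr_free set set ring)"
  unfolding cyc_klr_def by (rule ideal.quotient_is_ring[OF ideal_cyc_ideal])

text \<open>
  Beads are numbered by the order in which they are placed, bead \<open>k\<close> lying on runner
  \<open>col is k\<close>. \<open>blocks is j k\<close>: bead \<open>k\<close> is placed after bead \<open>j\<close>, on the same or an adjacent
  runner, and so directly obstructs the way of bead \<open>j\<close> upwards.
\<close>

definition blocks :: "int list \<Rightarrow> nat \<Rightarrow> nat \<Rightarrow> bool"
  where "blocks is j k \<longleftrightarrow> 1 \<le> j \<and> j < k \<and> k \<le> length is \<and> \<bar>col is j - col is k\<bar> \<le> 1"

definition remains :: "int list \<Rightarrow> nat \<Rightarrow> nat \<Rightarrow> bool"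
  where "remains is r k \<longleftrightarrow> (blocks is)\<^sup>*\<^sup>* k r"

text \<open>
  Passing from the antigravity configuration to the \<open>r\<close>-stable configuration \<open>a\<^sub>r(is)\<close> deletes
  beads but never empties a runner, so both have the same set of occupied runners.
\<close>

definition antigravity_supp :: "int list \<Rightarrow> nat \<Rightarrow> int set"
  where "antigravity_supp is r = {col is k | k. remains is r k}"

definition antigravity_bound :: "int multiset \<Rightarrow> int list \<Rightarrow> nat \<Rightarrow> nat"
  where "antigravity_bound \<Lambda> is r = (\<Sum>j\<in>antigravity_supp is r. count \<Lambda> j)"

lemma finite_antigravity_supp: "finite (antigravity_supp is r)"
proof -
  have "k \<le> r" if "remains is r k" for k
    using that unfolding remains_def by (induction rule: converse_rtranclp_induct) (auto simp: blocks_def)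
  then have "antigravity_supp is r \<subseteq> col is ` {..r}"
    by (auto simp: antigravity_supp_def)
  then show ?thesis
    by (rule finite_subset) simp
qed

end

(*
  Let x be the dot on the last strand of u c, where c is the colour of the anchored bead, and let N
  be the sum of the lambda_j over the colours j trapped below it.  That x^N vanishes on u c is shown
  by induction on the length of u.  Strands of distant colours may be exchanged.  Reading u from the
  right, one collects an arm c+j, ..., c+1 and a leg c-l, ..., c-1 in front of c, until the next
  strand a falls into one of the following cases.
  - a is distant from everything collected: it can be moved off to the right of the anchor.
  - a extends the arm or the leg: the collection goes on.
  - a = c: locally the word is c c, c b c or a diamond c (c+1) (c-1) c.  On c c, the nilHecke relations
    turn x_1^N = 0 into x_2^N = 0 and into the vanishing of the complete symmetric sum of degree
    N - 1; the words c b c are reduced to this by the braid relation, and the diamond by writing the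
    difference of the two outer dots as a difference of two double crossings.
  - a occurs in the arm or the leg: the braid relation produces a repeated strand a a, one copy of
    which can be moved to the right of the anchor.
  If u is used up, all colours are distinct, and x^n (x + y) = 0 and y^k = 0 give x^(n+k) = 0, where
  the exponents n and k are sums over disjoint sets of colours.
*)

theory Submission
  imports Defs
begin

section \<open>Nilpotency from the local relations\<close>

text \<open>For commuting arguments this is the complete homogeneous symmetric polynomial of degree
  \<open>n - 1\<close>, the sum of all \<open>x ^ i * y ^ j\<close> with
  \<open>i + j = n - 1\<close>. The shifted index makes it the quotient of
  \<open>x ^ n - y ^ n\<close> by \<open>x - y\<close>, including the value 0 at
  \<open>n = 0\<close>.\<close>

fun complete_sum :: "'a::{ring,monoid_mult} \<Rightarrow> 'a \<Rightarrow> nat \<Rightarrow> 'a" where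
  "complete_sum x y 0 = 0"
| "complete_sum x y (Suc n) = x ^ n + complete_sum x y n * y"

lemma complete_sum_mult_diff:
  fixes x y :: "'a::{ring,monoid_mult}"
  assumes "x * y = y * x"
  shows "complete_sum x y n * (x - y) = x ^ n - y ^ n"
proof (induction n)
  case (Suc n)
  have "(x - y) * y = y * (x - y)"
    using assms by (simp add: algebra_simps)
  then have "complete_sum x y n * y * (x - y) = (x ^ n - y ^ n) * y"
    by (metis Suc.IH mult.assoc)
  then show ?case
    by (simp add: algebra_simps power_commutes)
qed simp

lemma complete_sum_commute:
  fixes x y z :: "'a::{ring,monoid_mult}"
  assumes "z * x = x * z" "z * y = y * z"
  shows "z * complete_sum x y n = complete_sum x y n * z"
proof (induction n)
  case (Suc n)
  have "z * x ^ n = x ^ n * z"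
    by (metis assms(1) power_commuting_commutes)
  moreover have "z * (complete_sum x y n * y) = complete_sum x y n * y * z"
    using Suc assms(2) by (metis mult.assoc)
  ultimately show ?case
    by (simp add: algebra_simps)
qed simp

text \<open>
  Strands are numbered from 0 here: \<open>\<xi> k\<close> is the dot on strand \<open>k\<close> and \<open>\<tau> k\<close> the crossing of the
  strands \<open>k\<close> and \<open>Suc k\<close>, summed over all sequences.  Setting \<open>e w = 0\<close> for \<open>w\<close> outside of
  \<open>Seq \<nu>\<close> makes the relations hold for all words.
\<close>

locale klr_relations =
  fixes e :: "int list \<Rightarrow> 'a::{ring,monoid_mult}" and \<xi> \<tau> :: "nat \<Rightarrow> 'a" and wt :: "int \<Rightarrow> nat"
  assumes xi_commute: "\<xi> p * \<xi> q = \<xi> q * \<xi> p"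
    and e_xi: "e w * \<xi> p = \<xi> p * e w"
    and tau_e: "\<tau> (length u) * e (u @ a # b # t) = e (u @ b # a # t) * \<tau> (length u)"
    and tau_xi_far: "p \<noteq> length u \<Longrightarrow> p \<noteq> Suc (length u) \<Longrightarrow>
      \<xi> p * \<tau> (length u) * e (u @ a # b # t) = \<tau> (length u) * \<xi> p * e (u @ a # b # t)"
    and tau_tau_same: "\<tau> (length u) * \<tau> (length u) * e (u @ a # a # t) = 0"
    and tau_tau_distant: "\<bar>a - b\<bar> > 1 \<Longrightarrow>
      \<tau> (length u) * \<tau> (length u) * e (u @ a # b # t) = e (u @ a # b # t)"
    and tau_tau_adjacent: "\<bar>a - b\<bar> = 1 \<Longrightarrow>
      \<tau> (length u) * \<tau> (length u) * e (u @ a # b # t) =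
        (\<xi> (length u) + \<xi> (Suc (length u))) * e (u @ a # b # t)"
    and xi_tau_left: "a \<noteq> b \<Longrightarrow>
      \<xi> (length u) * \<tau> (length u) * e (u @ a # b # t) = \<tau> (length u) * \<xi> (Suc (length u)) * e (u @ a # b # t)"
    and xi_tau_right: "a \<noteq> b \<Longrightarrow>
      \<xi> (Suc (length u)) * \<tau> (length u) * e (u @ a # b # t) = \<tau> (length u) * \<xi> (length u) * e (u @ a # b # t)"
    and nil_left: "\<xi> (length u) * \<tau> (length u) * e (u @ a # a # t) =
      \<tau> (length u) * \<xi> (Suc (length u)) * e (u @ a # a # t) + e (u @ a # a # t)"
    and nil_right: "\<tau> (length u) * \<xi> (length u) * e (u @ a # a # t) =
      \<xi> (Suc (length u)) * \<tau> (length u) * e (u @ a # a # t) + e (u @ a # a # t)"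
    and braid: "\<bar>a - b\<bar> = 1 \<Longrightarrow>
      e (u @ a # b # a # t) =
        \<tau> (length u) * \<tau> (Suc (length u)) * \<tau> (length u) * e (u @ a # b # a # t) -
        \<tau> (Suc (length u)) * \<tau> (length u) * \<tau> (Suc (length u)) * e (u @ a # b # a # t)"
    and cyclotomic: "\<xi> 0 ^ wt a * e (a # t) = 0"
begin

section \<open>Polynomials in the dots passing through crossings\<close>

abbreviation H :: "nat \<Rightarrow> nat \<Rightarrow> nat \<Rightarrow> 'a" where "H p q \<equiv> complete_sum (\<xi> p) (\<xi> q)"

lemma tau_e_assoc:
  "\<tau> (length u) * (e (u @ a # b # t) * z) = e (u @ b # a # t) * (\<tau> (length u) * z)"
  by (simp add: mult.assoc[symmetric] tau_e)

lemma e_xi_power: "e w * \<xi> p ^ n = \<xi> p ^ n * e w"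
  by (metis e_xi power_commuting_commutes)

lemma xi_power_commute: "\<xi> p ^ n * \<xi> q = \<xi> q * \<xi> p ^ n"
  by (metis xi_commute power_commuting_commutes)

lemma xi_H: "\<xi> r * H p q n = H p q n * \<xi> r"
  by (rule complete_sum_commute) (rule xi_commute)+

text \<open>Strands of distinct colours cross without an error term, so a dot just follows its
  strand. The transposition merges the three cases of its position.\<close>

lemma xi_tau:
  assumes "a \<noteq> b"
  shows "\<xi> p * \<tau> (length u) * e (u @ a # b # t) =
    \<tau> (length u) * \<xi> (transpose (length u) (Suc (length u)) p) * e (u @ a # b # t)"
proof -
  consider "p = length u" | "p = Suc (length u)" | "p \<noteq> length u" "p \<noteq> Suc (length u)" by blast
  then show ?thesis
    by cases (simp_all add: xi_tau_left xi_tau_right tau_xi_far assms)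
qed

text \<open>The relation \<open>F d = d G\<close> is available only in front of \<open>e v\<close>.
  As \<open>G\<close> commutes with \<open>e v\<close>, each factor already moved can be parked
  behind the idempotent, which frees the relation for the next one.\<close>

lemma power_intertwine:
  assumes "F * d * e v = d * G * e v" "e v * G = G * e v"
  shows "F ^ n * d * e v = d * G ^ n * e v"
proof (induction n)
  case (Suc n)
  have "F ^ Suc n * d * e v = F * (d * G ^ n * e v)"
    by (metis Suc.IH mult.assoc power_Suc)
  also have "\<dots> = F * d * e v * G ^ n"
    by (metis assms(2) mult.assoc power_commuting_commutes)
  also have "\<dots> = d * G * e v * G ^ n"
    using assms(1) by simp
  also have "\<dots> = d * G ^ Suc n * e v"
    by (metis assms(2) mult.assoc power_Suc power_commuting_commutes)
  finally show ?case .
qed simp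

lemma xi_power_tau:
  assumes "a \<noteq> b"
  shows "\<xi> p ^ n * \<tau> (length u) * e (u @ a # b # t) =
    \<tau> (length u) * \<xi> (transpose (length u) (Suc (length u)) p) ^ n * e (u @ a # b # t)"
  by (rule power_intertwine[OF xi_tau[OF assms] e_xi])

lemma xi_power_tau_far:
  assumes "p \<noteq> length u" "p \<noteq> Suc (length u)"
  shows "\<xi> p ^ n * \<tau> (length u) * e (u @ a # b # t) = \<tau> (length u) * \<xi> p ^ n * e (u @ a # b # t)"
  by (rule power_intertwine[OF tau_xi_far[OF assms] e_xi])

lemma H_tau:
  fixes u t :: "int list" and p q :: nat
  assumes "a \<noteq> b"
  defines "s \<equiv> transpose (length u) (Suc (length u))"
  shows "H p q n * \<tau> (length u) * e (u @ a # b # t) = \<tau> (length u) * H (s p) (s q) n * e (u @ a # b # t)"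
proof (induction n)
  case (Suc n)
  let ?w = "u @ a # b # t" and ?d = "\<tau> (length u)"
  have "H p q n * \<xi> q * ?d * e ?w = H p q n * (?d * \<xi> (s q) * e ?w)"
    unfolding s_def by (simp add: mult.assoc xi_tau[OF assms(1), unfolded mult.assoc])
  also have "\<dots> = (H p q n * ?d * e ?w) * \<xi> (s q)"
    by (simp add: mult.assoc e_xi)
  also have "\<dots> = ?d * (H (s p) (s q) n * \<xi> (s q)) * e ?w"
    by (simp add: Suc.IH) (simp add: mult.assoc e_xi)
  finally show ?case
    using xi_power_tau[OF assms(1)] by (simp add: distrib_left distrib_right s_def)
qed simp

text \<open>\<open>F\<close> passes the upper crossing and becomes \<open>G\<close> on the exchanged
  word, where it vanishes. For distinct colours the double crossing is the idempotent or a sum of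
  two dots, so vanishing on one word gives a relation on the other.\<close>

lemma double_crossing_zero:
  assumes "F * \<tau> (length u) * e (u @ b # a # t) = \<tau> (length u) * G * e (u @ b # a # t)"
    and "G * e (u @ b # a # t) = 0"
  shows "F * (\<tau> (length u) * \<tau> (length u) * e (u @ a # b # t)) = 0"
proof -
  have "F * (\<tau> (length u) * \<tau> (length u) * e (u @ a # b # t)) =
      F * \<tau> (length u) * e (u @ b # a # t) * \<tau> (length u)"
    by (simp add: mult.assoc tau_e tau_e_assoc)
  also have "\<dots> = \<tau> (length u) * (G * e (u @ b # a # t)) * \<tau> (length u)"
    by (simp add: assms(1) mult.assoc[symmetric])
  finally show ?thesis
    by (simp add: assms(2))
qed

text \<open>The idempotent of \<open>a b a\<close> is a difference of two triple crossings, one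
  through \<open>b a a\<close> and one through \<open>a a b\<close>. On either side \<open>F\<close>
  has to pass only the topmost crossing, whose strands have distinct colours, to meet a word on
  which it vanishes.\<close>

lemma braid_zero:
  fixes u t :: "int list"
  assumes "\<bar>a - b\<bar> = 1"
    and "F * \<tau> (length u) * e (u @ b # a # a # t) = \<tau> (length u) * F1 * e (u @ b # a # a # t)"
    and "F1 * e (u @ b # a # a # t) = 0"
    and "F * \<tau> (Suc (length u)) * e (u @ a # a # b # t) = \<tau> (Suc (length u)) * F2 * e (u @ a # a # b # t)"
    and "F2 * e (u @ a # a # b # t) = 0"
  shows "F * e (u @ a # b # a # t) = 0"
proof -
  let ?k = "length u"
  let ?w = "u @ a # b # a # t" and ?v = "u @ b # a # a # t" and ?v' = "u @ a # a # b # t"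
  have F0: "F * \<tau> ?k * e ?v = 0"
    by (subst assms(2)) (simp add: mult.assoc assms(3))
  have F0': "F * \<tau> (Suc ?k) * e ?v' = 0"
    by (subst assms(4)) (simp add: mult.assoc assms(5))
  have De: "\<tau> (Suc ?k) * e (u @ x # y # z # t) = e (u @ x # z # y # t) * \<tau> (Suc ?k)" for x y z
    using tau_e[of "u @ [x]" y z t] by simp
  have De_assoc: "\<tau> (Suc ?k) * (e (u @ x # y # z # t) * c) = e (u @ x # z # y # t) * (\<tau> (Suc ?k) * c)" for x y z c
    using tau_e_assoc[of "u @ [x]" y z t] by simp
  have "\<tau> ?k * \<tau> (Suc ?k) * \<tau> ?k * e ?w = \<tau> ?k * (\<tau> (Suc ?k) * (e ?v * \<tau> ?k))"
    by (simp add: mult.assoc tau_e)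
  also have "\<dots> = \<tau> ?k * e ?v * (\<tau> (Suc ?k) * \<tau> ?k)"
    by (simp add: mult.assoc De_assoc)
  finally have "F * (\<tau> ?k * \<tau> (Suc ?k) * \<tau> ?k * e ?w) = F * \<tau> ?k * e ?v * (\<tau> (Suc ?k) * \<tau> ?k)"
    by (simp add: mult.assoc)
  then have 1: "F * (\<tau> ?k * \<tau> (Suc ?k) * \<tau> ?k * e ?w) = 0"
    by (simp add: F0)
  have "\<tau> (Suc ?k) * \<tau> ?k * \<tau> (Suc ?k) * e ?w = \<tau> (Suc ?k) * (\<tau> ?k * (e ?v' * \<tau> (Suc ?k)))"
    by (simp add: mult.assoc De)
  also have "\<dots> = \<tau> (Suc ?k) * e ?v' * (\<tau> ?k * \<tau> (Suc ?k))"
    by (simp add: mult.assoc tau_e_assoc)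
  finally have "F * (\<tau> (Suc ?k) * \<tau> ?k * \<tau> (Suc ?k) * e ?w) = F * \<tau> (Suc ?k) * e ?v' * (\<tau> ?k * \<tau> (Suc ?k))"
    by (simp add: mult.assoc)
  then have 2: "F * (\<tau> (Suc ?k) * \<tau> ?k * \<tau> (Suc ?k) * e ?w) = 0"
    by (simp add: F0')
  show ?thesis
    by (subst braid[OF assms(1)]) (simp only: right_diff_distrib 1 2 diff_self)
qed

section \<open>Consequences of the nilHecke and quadratic relations\<close>

text \<open>Every dot that passes the crossing of two equal strands leaves an error term without
  crossing. The \<open>n\<close> error terms add up to the complete symmetric sum.\<close>

lemma nil_power:
  "\<tau> (length u) * \<xi> (length u) ^ n * e (u @ a # a # t) =
    \<xi> (Suc (length u)) ^ n * \<tau> (length u) * e (u @ a # a # t)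
      + H (Suc (length u)) (length u) n * e (u @ a # a # t)"
proof (induction n)
  case (Suc n)
  let ?k = "length u" and ?e = "e (u @ a # a # t)"
  have "\<tau> ?k * \<xi> ?k ^ Suc n * ?e = \<tau> ?k * \<xi> ?k ^ n * ?e * \<xi> ?k"
    by (simp only: power_Suc2 mult.assoc e_xi)
  also have "\<dots> = \<xi> (Suc ?k) ^ n * (\<tau> ?k * \<xi> ?k * ?e) + H (Suc ?k) ?k n * \<xi> ?k * ?e"
    by (simp add: Suc.IH distrib_right) (simp add: mult.assoc e_xi)
  also have "\<dots> = \<xi> (Suc ?k) ^ Suc n * \<tau> ?k * ?e + H (Suc ?k) ?k (Suc n) * ?e"
    by (subst nil_right) (simp only: power_Suc2 complete_sum.simps distrib_left distrib_right mult.assoc add.assoc)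
  finally show ?case .
qed simp

text \<open>By \<open>nil_power\<close> the hypothesis leaves a sum of two terms equal to 0.
  Multiplying it by the crossing on the right kills the term with a crossing, as the square of the
  crossing is 0.\<close>

lemma nil_zero:
  assumes "\<xi> (length u) ^ n * e (u @ a # a # t) = 0"
  shows "H (Suc (length u)) (length u) n * e (u @ a # a # t) = 0"
    and "\<xi> (Suc (length u)) ^ n * e (u @ a # a # t) = 0"
proof -
  let ?k = "length u" and ?e = "e (u @ a # a # t)"
  let ?H = "H (Suc ?k) ?k n"
  have h: "\<xi> (Suc ?k) ^ n * \<tau> ?k * ?e + ?H * ?e = 0"
    using nil_power[of u n a t] assms by (simp add: mult.assoc)
  have "?H * \<tau> ?k * ?e = (?H * ?e) * \<tau> ?k"
    by (simp add: mult.assoc tau_e)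
  also have "\<dots> = - (\<xi> (Suc ?k) ^ n * \<tau> ?k * ?e) * \<tau> ?k"
    using h by (metis add.commute eq_neg_iff_add_eq_0)
  also have "\<dots> = - (\<xi> (Suc ?k) ^ n * (\<tau> ?k * \<tau> ?k * ?e))"
    by (simp add: mult.assoc tau_e tau_e_assoc)
  finally have HD: "?H * \<tau> ?k * ?e = 0"
    by (simp add: tau_tau_same)
  \<comment> \<open>The idempotent is a combination of dot times crossing and crossing times dot.
    Hence whatever commutes with the dots and kills the crossing kills the idempotent; this is used
    for \<open>?H\<close> and then for the power of the dot.\<close>
  have e: "?e = \<xi> ?k * \<tau> ?k * ?e - \<tau> ?k * \<xi> (Suc ?k) * ?e"
    by (simp add: nil_left)
  have "?H * ?e = ?H * (\<xi> ?k * \<tau> ?k * ?e - \<tau> ?k * \<xi> (Suc ?k) * ?e)"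
    using e by simp
  also have "\<dots> = \<xi> ?k * (?H * \<tau> ?k * ?e) - (?H * \<tau> ?k * ?e) * \<xi> (Suc ?k)"
    by (simp add: right_diff_distrib mult.assoc e_xi) (simp add: mult.assoc[symmetric] xi_H)
  finally show He: "?H * ?e = 0"
    by (simp add: HD)
  then have XD: "\<xi> (Suc ?k) ^ n * \<tau> ?k * ?e = 0"
    using h by simp
  have "\<xi> (Suc ?k) ^ n * ?e = \<xi> (Suc ?k) ^ n * (\<xi> ?k * \<tau> ?k * ?e - \<tau> ?k * \<xi> (Suc ?k) * ?e)"
    using e by simp
  also have "\<dots> = \<xi> ?k * (\<xi> (Suc ?k) ^ n * \<tau> ?k * ?e) - (\<xi> (Suc ?k) ^ n * \<tau> ?k * ?e) * \<xi> (Suc ?k)"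
    by (simp add: right_diff_distrib mult.assoc e_xi) (simp add: mult.assoc[symmetric] xi_power_commute)
  finally show "\<xi> (Suc ?k) ^ n * ?e = 0"
    by (simp add: XD)
qed

text \<open>The first hypothesis trades a factor \<open>\<xi> q\<close> beyond the
  \<open>n\<close>-th power for \<open>- \<xi> p\<close>, and \<open>m\<close> factors
  \<open>\<xi> p\<close> give 0.\<close>

lemma adjacent_zero:
  assumes "\<xi> q ^ n * (\<xi> p + \<xi> q) * e w = 0" "\<xi> p ^ m * e w = 0"
  shows "\<xi> q ^ (n + m) * e w = 0"
proof -
  \<comment> \<open>Interpolates between the known case \<open>j = 0, i = m\<close> and the goal
    \<open>j = m, i = 0\<close>.\<close>
  have "\<xi> q ^ (n + j) * \<xi> p ^ i * e w = 0" if "i + j = m" for i j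
    using that
  proof (induction j arbitrary: i)
    case 0
    then show ?case using assms(2) by (simp add: mult.assoc)
  next
    case (Suc j)
    have "\<xi> q * \<xi> q ^ (n + j) = \<xi> q ^ (j + Suc n)" "\<xi> q ^ (n + j) = \<xi> q ^ (j + n)"
      by (simp_all add: add.commute)
    then have "(\<xi> q * \<xi> q ^ (n + j) + \<xi> q ^ (n + j) * \<xi> p) * e w
        = \<xi> q ^ j * (\<xi> q ^ n * (\<xi> p + \<xi> q) * e w)"
      by (simp only: power_add power_Suc2 distrib_left distrib_right mult.assoc add.commute)
    then have z: "\<xi> q * \<xi> q ^ (n + j) * e w = - (\<xi> q ^ (n + j) * \<xi> p * e w)"
      using assms(1) by (simp add: distrib_right eq_neg_iff_add_eq_0)
    have "\<xi> q ^ (n + Suc j) * \<xi> p ^ i * e w = \<xi> q * \<xi> q ^ (n + j) * e w * \<xi> p ^ i"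
      by (simp add: mult.assoc e_xi_power)
    also have "\<dots> = - (\<xi> q ^ (n + j) * \<xi> p ^ Suc i * e w)"
      by (simp add: z) (simp add: mult.assoc e_xi_power)
    finally show ?case
      using Suc.IH[of "Suc i"] Suc.prems by simp
  qed
  from this[of 0 m] show ?thesis by simp
qed

text \<open>With \<open>Y = \<xi> p ^ n\<close> and \<open>x1, x2\<close> the dots on the two equal strands, the vanishing of
  \<open>Y (x2 + x3)\<close> together with its commutator with the crossing \<open>d\<close> gives \<open>Y = Y (x1 - x2) d\<close>,
  hence \<open>Y d = 0\<close>, hence \<open>Y = Y (x1 d - d x2) = 0\<close>.\<close>

lemma repeated_zero:
  fixes u t :: "int list"
  assumes p: "p \<noteq> length u" "p \<noteq> Suc (length u)" and ab: "\<bar>a - b\<bar> = 1"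
    and z: "\<xi> (transpose (Suc (length u)) (Suc (Suc (length u))) p) ^ n * e (u @ a # b # a # t) = 0"
  shows "\<xi> p ^ n * e (u @ a # a # b # t) = 0"
proof -
  let ?k = "length u" and ?e = "e (u @ a # a # b # t)"
  let ?Y = "\<xi> p ^ n" and ?d = "\<tau> (length u)"
  let ?x1 = "\<xi> (length u)" and ?x2 = "\<xi> (Suc (length u))" and ?x3 = "\<xi> (Suc (Suc (length u)))"
  have "?Y * (\<tau> (Suc ?k) * \<tau> (Suc ?k) * ?e) = 0"
    using double_crossing_zero[OF xi_power_tau[of b a p n "u @ [a]" t]] z ab by auto
  then have Y: "?Y * (?x2 + ?x3) * ?e = 0"
    using tau_tau_adjacent[of a b "u @ [a]" t] ab by (simp add: mult.assoc)
  have Yt: "?Y * ?d * ?e = ?d * ?Y * ?e"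
    by (rule xi_power_tau_far[OF p])
  have x3d: "?x3 * ?d * ?e = ?d * ?x3 * ?e"
    by (rule tau_xi_far) auto
  have de: "?d * ?e = ?e * ?d"
    by (rule tau_e)
  have eS: "?e * (?x2 + ?x3) = (?x2 + ?x3) * ?e"
    by (simp add: distrib_left distrib_right e_xi)
  have "?Y * ?d * (?x2 + ?x3) * ?e = (?Y * ?d * ?e) * (?x2 + ?x3)"
    by (simp only: mult.assoc eS)
  also have "\<dots> = ?d * (?Y * (?x2 + ?x3) * ?e)"
    by (simp only: Yt) (simp only: mult.assoc eS)
  finally have "?Y * ?d * (?x2 + ?x3) * ?e = 0"
    by (simp only: Y mult_zero_right)
  then have 1: "?Y * (?d * ?x2 * ?e + ?d * ?x3 * ?e) = 0"
    by (simp only: distrib_left distrib_right mult.assoc)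
  have "?Y * (?x2 + ?x3) * ?d * ?e = (?Y * (?x2 + ?x3) * ?e) * ?d"
    by (simp add: mult.assoc de)
  then have "?Y * (?x2 + ?x3) * ?d * ?e = 0"
    by (simp only: Y mult_zero_left)
  then have 2: "?Y * (?x2 * ?d * ?e + ?d * ?x3 * ?e) = 0"
    by (simp only: distrib_left distrib_right mult.assoc x3d[unfolded mult.assoc])
  have Q: "?Y * (?d * ?x3 * ?e) = - (?Y * (?x2 * ?d * ?e))"
    using 2 by (simp only: distrib_left eq_neg_iff_add_eq_0 add.commute)
  have "?Y * (?x1 * ?d * ?e - ?e + ?d * ?x3 * ?e) = 0"
    using 1 by (simp add: nil_left)
  then have 3: "?Y * ?e = ?Y * (?x1 * ?d * ?e) - ?Y * (?x2 * ?d * ?e)"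
    by (simp add: distrib_left right_diff_distrib Q diff_eq_eq eq_diff_eq add.commute)
  have "?Y * ?d * ?e = ?Y * ?e * ?d"
    by (simp add: mult.assoc de)
  also have "\<dots> = ?Y * (?x1 * (?d * ?d * ?e)) - ?Y * (?x2 * (?d * ?d * ?e))"
    by (subst 3) (simp add: left_diff_distrib mult.assoc de tau_e_assoc)
  finally have Yt0: "?Y * ?d * ?e = 0"
    by (simp add: tau_tau_same)
  have "?Y * ?e = ?Y * (?x1 * ?d * ?e - ?d * ?x2 * ?e)"
    by (simp add: nil_left)
  also have "\<dots> = ?x1 * (?Y * ?d * ?e) - (?Y * ?d * ?e) * ?x2"
    by (simp add: right_diff_distrib mult.assoc e_xi) (simp add: mult.assoc[symmetric] xi_power_commute)
  finally show ?thesis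
    by (simp add: Yt0)
qed

section \<open>Powers of the dot on the anchored strand\<close>

text \<open>The anchor \<open>c\<close> stands behind the prefix \<open>u\<close>. The suffix
  \<open>t\<close> is arbitrary so that strands moved to the right of the anchor can be absorbed
  into it.\<close>

definition vanishes :: "int list \<Rightarrow> int \<Rightarrow> nat \<Rightarrow> bool" where
  "vanishes u c n \<longleftrightarrow> (\<forall>t. \<xi> (length u) ^ n * e (u @ c # t) = 0)"

lemma vanishes_mono:
  assumes "vanishes u c n" "n \<le> k"
  shows "vanishes u c k"
proof -
  have "\<xi> p ^ k = \<xi> p ^ (k - n) * \<xi> p ^ n" for p
    using assms(2) by (simp flip: power_add)
  then show ?thesis
    using assms(1) by (simp add: vanishes_def mult.assoc)
qed

lemma transpose_far: "p \<noteq> a \<Longrightarrow> p \<noteq> b \<Longrightarrow> transpose a b p = p"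
  by (simp add: transpose_def)

text \<open>For distant colours the double crossing is the idempotent itself.\<close>

lemma swap_distant_zero:
  assumes "\<bar>a - b\<bar> > 1"
    and "\<xi> (transpose (length u) (Suc (length u)) p) ^ n * e (u @ b # a # t) = 0"
  shows "\<xi> p ^ n * e (u @ a # b # t) = 0"
  using double_crossing_zero[OF xi_power_tau assms(2)] tau_tau_distant[OF assms(1)] assms(1) by force

lemma vanishes_swap_inner:
  assumes "\<bar>a - b\<bar> > 1" "vanishes (u @ b # a # v) c n"
  shows "vanishes (u @ a # b # v) c n"
  unfolding vanishes_def
proof
  fix t
  have "transpose (length u) (Suc (length u)) (length (u @ a # b # v)) = length (u @ b # a # v)"
    by (simp add: transpose_far)
  then show "\<xi> (length (u @ a # b # v)) ^ n * e ((u @ a # b # v) @ c # t) = 0"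
    using swap_distant_zero[OF assms(1), of u _ n "v @ c # t"] assms(2)
    unfolding vanishes_def by (metis append.assoc append_Cons)
qed

text \<open>Exchanging \<open>a\<close> with the anchor makes \<open>a\<close> the first letter of
  the arbitrary suffix.\<close>

lemma vanishes_drop_last:
  assumes "\<bar>a - c\<bar> > 1" "vanishes u c n"
  shows "vanishes (u @ [a]) c n"
  using swap_distant_zero[OF assms(1), of u "Suc (length u)" n] assms(2)
  by (simp add: vanishes_def)

lemma vanishes_move_inner:
  assumes "\<forall>y\<in>set ys. \<bar>x - y\<bar> > 1" "vanishes (u @ ys @ x # v) c n"
  shows "vanishes (u @ x # ys @ v) c n"
  using assms
proof (induction ys arbitrary: u)
  case (Cons y ys)
  have "vanishes ((u @ [y]) @ x # ys @ v) c n"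
    by (rule Cons.IH) (use Cons.prems in simp_all)
  then show ?case
    using vanishes_swap_inner[of x y u "ys @ v"] Cons.prems by simp
qed simp

lemma vanishes_swap_blocks:
  assumes "\<forall>x\<in>set xs. \<forall>y\<in>set ys. \<bar>x - y\<bar> > 1" "vanishes (u @ ys @ xs @ v) c n"
  shows "vanishes (u @ xs @ ys @ v) c n"
  using assms
proof (induction xs arbitrary: u v)
  case (Cons x xs)
  have "vanishes (u @ x # ys @ xs @ v) c n"
    by (rule vanishes_move_inner) (use Cons.prems in simp_all)
  then have "vanishes ((u @ [x]) @ xs @ ys @ v) c n"
    by (intro Cons.IH) (use Cons.prems in simp_all)
  then show ?case
    by simp
qed simp

lemma vanishes_drop:
  assumes "\<forall>y\<in>set ys. \<bar>a - y\<bar> > 1" "\<bar>a - c\<bar> > 1" "vanishes (u @ ys) c n"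
  shows "vanishes (u @ a # ys) c n"
  using vanishes_move_inner[OF assms(1), of u "[]"] vanishes_drop_last[OF assms(2,3)] by simp

lemma vanishes_double:
  assumes "vanishes u c n"
  shows "vanishes (u @ [c]) c n"
  using nil_zero(2)[of u n c] assms by (simp add: vanishes_def)

text \<open>With \<open>x\<close> and \<open>y\<close> the dots on \<open>b\<close> and
  \<open>c\<close>, the double crossing is \<open>x + y\<close>, which gives
  \<open>y ^ n * (x + y) = 0\<close>, while \<open>x ^ k = 0\<close>. This is the move in which
  exponents add up.\<close>

lemma vanishes_hook:
  assumes "\<bar>b - c\<bar> = 1" "vanishes u c n" "vanishes u b k"
  shows "vanishes (u @ [b]) c (n + k)"
  unfolding vanishes_def
proof
  fix t
  have "\<xi> (Suc (length u)) ^ n * (\<tau> (length u) * \<tau> (length u) * e (u @ b # c # t)) = 0"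
    by (rule double_crossing_zero[OF xi_power_tau]) (use assms in \<open>auto simp: vanishes_def\<close>)
  then have "\<xi> (Suc (length u)) ^ n * (\<xi> (length u) + \<xi> (Suc (length u))) * e (u @ b # c # t) = 0"
    using tau_tau_adjacent[OF assms(1), of u t] by (simp add: mult.assoc)
  then show "\<xi> (length (u @ [b])) ^ (n + k) * e ((u @ [b]) @ c # t) = 0"
    using adjacent_zero[of "Suc (length u)" n "length u" "u @ b # c # t" k] assms(3)
    by (simp add: vanishes_def)
qed

text \<open>The braid relation on \<open>c b c\<close> leads to \<open>c c b\<close> and
  \<open>b c c\<close>, where the anchor has a copy of itself as left neighbour and
  \<open>vanishes_double\<close> applies.\<close>

lemma vanishes_sandwich:
  assumes "\<bar>b - c\<bar> = 1" "vanishes u c n" "vanishes (u @ [b]) c n"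
  shows "vanishes (u @ [c, b]) c n"
  unfolding vanishes_def
proof
  fix t
  let ?k = "length u"
  have 1: "\<xi> (Suc ?k) ^ n * e (u @ c # c # b # t) = 0"
    using vanishes_double[OF assms(2)] by (simp add: vanishes_def)
  have 2: "\<xi> (Suc (Suc ?k)) ^ n * e (u @ b # c # c # t) = 0"
    using vanishes_double[OF assms(3)] by (simp add: vanishes_def)
  have "\<xi> (Suc (Suc ?k)) ^ n * e (u @ c # b # c # t) = 0"
  proof (rule braid_zero[OF _ _ 2 _ 1])
    show "\<xi> (Suc (Suc ?k)) ^ n * \<tau> (Suc ?k) * e (u @ c # c # b # t) =
      \<tau> (Suc ?k) * \<xi> (Suc ?k) ^ n * e (u @ c # c # b # t)"
      using xi_power_tau[of c b "Suc (Suc ?k)" n "u @ [c]" t] assms(1) by force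
  qed (use assms(1) in \<open>auto intro!: xi_power_tau_far\<close>)
  then show "\<xi> (length (u @ [c, b])) ^ n * e ((u @ [c, b]) @ c # t) = 0"
    by simp
qed

text \<open>The same braid argument for the complete symmetric sum in the dots of the two outer
  strands; it supplies the input for the diamond.\<close>

lemma sandwich_H_zero:
  assumes "\<bar>b - c\<bar> = 1" "vanishes u c n" "vanishes (u @ [b]) c n"
  shows "H (Suc (Suc (length u))) (length u) n * e (u @ c # b # c # t) = 0"
proof -
  let ?k = "length u"
  have 1: "H (Suc ?k) ?k n * e (u @ c # c # b # t) = 0"
    using nil_zero(1)[of u n c "b # t"] assms(2) by (simp add: vanishes_def)
  have 2: "H (Suc (Suc ?k)) (Suc ?k) n * e (u @ b # c # c # t) = 0"
    using nil_zero(1)[of "u @ [b]" n c t] assms(3) by (simp add: vanishes_def)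
  show ?thesis
  proof (rule braid_zero[OF _ _ 2 _ 1])
    show "H (Suc (Suc ?k)) ?k n * \<tau> ?k * e (u @ b # c # c # t) =
      \<tau> ?k * H (Suc (Suc ?k)) (Suc ?k) n * e (u @ b # c # c # t)"
      using H_tau[of b c "Suc (Suc ?k)" ?k n u "c # t"] assms(1) by (force simp: transpose_far)
    show "H (Suc (Suc ?k)) ?k n * \<tau> (Suc ?k) * e (u @ c # c # b # t) =
      \<tau> (Suc ?k) * H (Suc ?k) ?k n * e (u @ c # c # b # t)"
      using H_tau[of c b "Suc (Suc ?k)" ?k n "u @ [c]" t] assms(1) by (force simp: transpose_far)
  qed (use assms(1) in auto)
qed

text \<open>The anchor itself takes the part of the adjacent strand in \<open>repeated_zero\<close>;
  the transposition carries its dot to the middle of \<open>a c a\<close>.\<close>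

lemma vanishes_repeated_last:
  assumes "\<bar>a - c\<bar> = 1" "vanishes (u @ [a]) c n"
  shows "vanishes (u @ [a, a]) c n"
  unfolding vanishes_def
proof
  fix t
  have "\<xi> (Suc (length u)) ^ n * e (u @ a # c # a # t) = 0"
    using assms(2) by (simp add: vanishes_def)
  then show "\<xi> (length (u @ [a, a])) ^ n * e ((u @ [a, a]) @ c # t) = 0"
    using repeated_zero[of "Suc (Suc (length u))" u a c n t] assms(1) by simp
qed

lemma vanishes_repeated:
  assumes "\<bar>a - b\<bar> = 1" "\<forall>y\<in>set w. \<bar>a - y\<bar> > 1" "\<bar>a - c\<bar> > 1"
    and "vanishes (u @ a # b # w) c n"
  shows "vanishes (u @ a # a # b # w) c n"
  unfolding vanishes_def
proof
  fix t
  let ?p = "length (u @ a # a # b # w)"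
  have "vanishes ((u @ [a, b]) @ a # w) c n"
    by (rule vanishes_drop) (use assms in simp_all)
  then have "\<xi> ?p ^ n * e (u @ a # b # a # w @ c # t) = 0"
    by (simp add: vanishes_def)
  then have "\<xi> ?p ^ n * e (u @ a # a # b # w @ c # t) = 0"
    by (intro repeated_zero) (use assms(1) in \<open>auto simp: transpose_far\<close>)
  then show "\<xi> ?p ^ n * e ((u @ a # a # b # w) @ c # t) = 0"
    by simp
qed

lemma vanishes_braid:
  assumes "\<bar>a - b\<bar> = 1" "vanishes (u @ b # a # a # w) c n" "vanishes (u @ a # a # b # w) c n"
  shows "vanishes (u @ a # b # a # w) c n"
  unfolding vanishes_def
proof
  fix t
  let ?p = "length (u @ a # b # a # w)"
  have 1: "\<xi> ?p ^ n * e (u @ b # a # a # w @ c # t) = 0" "\<xi> ?p ^ n * e (u @ a # a # b # w @ c # t) = 0"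
    using assms(2,3) by (simp_all add: vanishes_def)
  have "\<xi> ?p ^ n * e (u @ a # b # a # w @ c # t) = 0"
  proof (rule braid_zero[OF assms(1) _ 1(1) _ 1(2)])
    show "\<xi> ?p ^ n * \<tau> (Suc (length u)) * e (u @ a # a # b # w @ c # t) =
        \<tau> (Suc (length u)) * \<xi> ?p ^ n * e (u @ a # a # b # w @ c # t)"
      using xi_power_tau_far[of ?p "u @ [a]" n] by simp
  qed (rule xi_power_tau_far, simp_all)
  then show "\<xi> ?p ^ n * e ((u @ a # b # a # w) @ c # t) = 0"
    by simp
qed

text \<open>The dots \<open>y\<close> and \<open>z\<close> on the two strands coloured \<open>c\<close> satisfy
  \<open>y ^ n = y ^ n - z ^ n = H (y - z) = H (y + x) - H (x + z)\<close>, where \<open>x\<close> is the dot on the strand \<open>d\<close>.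
  Each of \<open>y + x\<close> and \<open>x + z\<close> is a double crossing, which pulls \<open>d\<close> out of the diamond.\<close>

lemma vanishes_diamond:
  assumes bd: "\<bar>b - c\<bar> = 1" "\<bar>d - c\<bar> = 1" "\<bar>b - d\<bar> > 1"
    and "vanishes u c n" "vanishes (u @ [b]) c n" "vanishes (u @ [d]) c n" "vanishes (u @ [d, b]) c n"
  shows "vanishes (u @ [c, b, d]) c n"
  unfolding vanishes_def
proof
  fix t
  let ?k = "length u"
  let ?k1 = "Suc ?k" let ?k2 = "Suc ?k1" let ?k3 = "Suc ?k2"
  let ?w = "u @ c # b # d # c # t"
  have "H ?k3 ?k n * (\<tau> ?k2 * \<tau> ?k2 * e ?w) = 0"
  proof -
    have "H ?k3 ?k n * \<tau> ?k2 * e (u @ c # b # c # d # t) = \<tau> ?k2 * H ?k2 ?k n * e (u @ c # b # c # d # t)"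
      using H_tau[of c d ?k3 ?k n "u @ [c, b]" t] bd(2) by (force simp: transpose_far)
    then show ?thesis
      using double_crossing_zero[of "H ?k3 ?k n" "u @ [c, b]" c d t "H ?k2 ?k n"]
        sandwich_H_zero[OF bd(1) assms(4,5)] by simp
  qed
  then have 1: "H ?k3 ?k n * (\<xi> ?k2 + \<xi> ?k3) * e ?w = 0"
    using tau_tau_adjacent[OF bd(2), of "u @ [c, b]" t] by (simp add: mult.assoc)
  have "H ?k3 ?k n * (\<tau> ?k * \<tau> ?k * e (u @ c # d # b # c # t)) = 0"
  proof -
    have "H ?k3 ?k n * \<tau> ?k * e (u @ d # c # b # c # t) = \<tau> ?k * H ?k3 ?k1 n * e (u @ d # c # b # c # t)"
      using H_tau[of d c ?k3 ?k n u "b # c # t"] bd(2) by (force simp: transpose_far)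
    then show ?thesis
      using double_crossing_zero[of "H ?k3 ?k n" u d c "b # c # t" "H ?k3 ?k1 n"]
        sandwich_H_zero[OF bd(1), of "u @ [d]"] assms(6,7) by simp
  qed
  then have 2: "H ?k3 ?k n * (\<xi> ?k + \<xi> ?k1) * e (u @ c # d # b # c # t) = 0"
    using tau_tau_adjacent[of c d u "b # c # t"] bd(2) by (simp add: mult.assoc abs_minus_commute)
  \<comment> \<open>Carries \<open>2\<close> from the word \<open>c d b c\<close> back to
    \<open>c b d c\<close> through the double crossing of the distant strands \<open>b\<close> and
    \<open>d\<close>. The dot on \<open>d\<close> moves from position \<open>?k1\<close> to
    \<open>?k2\<close>.\<close>
  have 3: "H ?k3 ?k n * (\<xi> ?k + \<xi> ?k2) * (\<tau> ?k1 * \<tau> ?k1 * e ?w) = 0"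
  proof -
    let ?v = "u @ c # d # b # c # t"
    have S: "(\<xi> ?k + \<xi> ?k2) * \<tau> ?k1 * e ?v = \<tau> ?k1 * (\<xi> ?k + \<xi> ?k1) * e ?v"
      using xi_tau[of d b ?k "u @ [c]" "c # t"] xi_tau[of d b ?k2 "u @ [c]" "c # t"] bd(3)
      by (force simp: transpose_far distrib_left distrib_right)
    have T: "H ?k3 ?k n * \<tau> ?k1 * e ?v = \<tau> ?k1 * H ?k3 ?k n * e ?v"
      using H_tau[of d b ?k3 ?k n "u @ [c]" "c # t"] bd(3) by (force simp: transpose_far)
    have eS: "(\<xi> ?k + \<xi> ?k1) * e ?v = e ?v * (\<xi> ?k + \<xi> ?k1)"
      by (simp add: distrib_left distrib_right e_xi)
    have "H ?k3 ?k n * (\<xi> ?k + \<xi> ?k2) * \<tau> ?k1 * e ?v = H ?k3 ?k n * (\<tau> ?k1 * (\<xi> ?k + \<xi> ?k1) * e ?v)"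
      by (simp only: mult.assoc S[unfolded mult.assoc])
    also have "\<dots> = (H ?k3 ?k n * \<tau> ?k1 * e ?v) * (\<xi> ?k + \<xi> ?k1)"
      by (simp only: mult.assoc eS)
    also have "\<dots> = \<tau> ?k1 * (H ?k3 ?k n * (\<xi> ?k + \<xi> ?k1)) * e ?v"
      by (simp only: T) (simp only: mult.assoc eS)
    finally show ?thesis
      using double_crossing_zero[of _ "u @ [c]" d b "c # t"] 2 by simp
  qed
  then have 3: "H ?k3 ?k n * (\<xi> ?k + \<xi> ?k2) * e ?w = 0"
    using tau_tau_distant[OF bd(3), of "u @ [c]" "c # t"] by simp
  have "\<xi> ?k3 ^ n * e ?w = (\<xi> ?k3 ^ n - \<xi> ?k ^ n) * e ?w"
    using assms(4) by (simp add: vanishes_def left_diff_distrib)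
  also have "\<dots> = H ?k3 ?k n * ((\<xi> ?k2 + \<xi> ?k3) - (\<xi> ?k + \<xi> ?k2)) * e ?w"
    by (simp add: xi_commute algebra_simps flip: complete_sum_mult_diff)
  also have "\<dots> = 0"
    using 1 3 by (simp only: right_diff_distrib left_diff_distrib diff_self)
  finally show "\<xi> (length (u @ [c, b, d])) ^ n * e ((u @ [c, b, d]) @ c # t) = 0"
    by simp
qed

end

section \<open>Trapped beads\<close>

definition attach :: "int \<Rightarrow> int set \<Rightarrow> int set" where
  "attach d A = (if \<exists>a\<in>A. \<bar>d - a\<bar> \<le> 1 then insert d A else A)"

text \<open>Only the colours of the trapped beads are recorded. \<open>foldr\<close> reads the word
  from its right end, so each bead is compared with the trapped beads placed after it; the start set
  is the colour of the anchor.\<close>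

definition trapped :: "int list \<Rightarrow> int set \<Rightarrow> int set" where
  "trapped u A = foldr attach u A"

lemma trapped_simps [simp]:
  "trapped [] A = A" "trapped (d # u) A = attach d (trapped u A)"
  "trapped (u @ v) A = trapped u (trapped v A)"
  by (simp_all add: trapped_def)

lemma attach_mono: "A \<subseteq> B \<Longrightarrow> attach d A \<subseteq> attach d B"
  by (auto simp: attach_def)

lemma attach_superset: "A \<subseteq> attach d A"
  by (auto simp: attach_def)

lemma finite_attach [simp]: "finite A \<Longrightarrow> finite (attach d A)"
  by (simp add: attach_def)

lemma attach_idem [simp]: "attach d (attach d A) = attach d A"
  by (auto simp: attach_def)

lemma trapped_mono: "A \<subseteq> B \<Longrightarrow> trapped u A \<subseteq> trapped u B"
  by (induction u) (auto simp: attach_mono)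

lemma finite_trapped [simp]: "finite A \<Longrightarrow> finite (trapped u A)"
  by (induction u) simp_all

lemma attach_commute: "\<bar>a - b\<bar> > 1 \<Longrightarrow> attach a (attach b A) = attach b (attach a A)"
  by (auto simp: attach_def)

lemma trapped_swap_blocks:
  assumes "\<forall>x\<in>set xs. \<forall>y\<in>set ys. \<bar>x - y\<bar> > 1"
  shows "trapped xs (trapped ys A) = trapped ys (trapped xs A)"
proof -
  have "attach x (trapped ys A) = trapped ys (attach x A)" if "\<forall>y\<in>set ys. \<bar>x - y\<bar> > 1" for x A
    using that by (induction ys) (auto simp: attach_commute)
  then show ?thesis
    using assms by (induction xs) auto
qed

text \<open>A chain of blocking beads changes its colour by at most 1 at a time, so it cannot jump
  over a colour missing from the word.\<close>

lemma trapped_below: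
  assumes "A \<subseteq> {..<c}" "c \<notin> set u"
  shows "trapped u A \<subseteq> {..<c}"
  using assms
proof (induction u)
  case (Cons a u)
  then have sub: "trapped u A \<subseteq> {..<c}" and "a \<noteq> c" by auto
  have "a < c" if "x \<in> trapped u A" "\<bar>a - x\<bar> \<le> 1" for x
    using that sub \<open>a \<noteq> c\<close> by fastforce
  then show ?case
    using sub by (auto simp: attach_def)
qed simp

lemma trapped_above:
  assumes "A \<subseteq> {c<..}" "c \<notin> set u"
  shows "trapped u A \<subseteq> {c<..}"
  using assms
proof (induction u)
  case (Cons a u)
  then have sub: "trapped u A \<subseteq> {c<..}" and "a \<noteq> c" by auto
  have "c < a" if "x \<in> trapped u A" "\<bar>a - x\<bar> \<le> 1" for x
    using that sub \<open>a \<noteq> c\<close> by fastforce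
  then show ?case
    using sub by (auto simp: attach_def)
qed simp

text \<open>The chains ending at \<open>b\<close> cannot pass \<open>c\<close> and those ending at
  \<open>c\<close> cannot pass \<open>b\<close>; since the two colours are neighbours, they stay on
  opposite sides.\<close>

lemma trapped_disjoint:
  assumes "\<bar>b - c\<bar> = 1" "b \<notin> set u" "c \<notin> set u"
  shows "trapped u {b} \<inter> trapped u {c} = {}"
proof (cases "b < c")
  case True
  then show ?thesis
    using trapped_below[of "{b}" c u] trapped_above[of "{c}" b u] assms by fastforce
next
  case False
  then show ?thesis
    using trapped_below[of "{c}" b u] trapped_above[of "{b}" c u] assms by fastforce
qed

section \<open>Vanishing with the weight of the trapped colours as exponent\<close>

context klr_relations begin

definition cost :: "int list \<Rightarrow> int \<Rightarrow> nat" where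
  "cost u c = sum wt (trapped u {c})"

definition cost_bounds :: "int list \<Rightarrow> int \<Rightarrow> bool" where
  "cost_bounds u c \<longleftrightarrow> vanishes u c (cost u c)"

text \<open>A larger trapped set only raises the exponent, so each move on words reduces to
  inclusions between trapped sets.\<close>

lemma cost_bounds_vanishes:
  assumes "cost_bounds u c" "trapped u {c} \<subseteq> trapped v {d}"
  shows "vanishes u c (cost v d)"
proof -
  have "cost u c \<le> cost v d"
    unfolding cost_def using assms(2) by (intro sum_mono2) auto
  then show ?thesis
    using assms(1) vanishes_mono by (auto simp: cost_bounds_def)
qed

lemma cost_bounds_swap_blocks:
  assumes "\<forall>x\<in>set xs. \<forall>y\<in>set ys. \<bar>x - y\<bar> > 1" "cost_bounds (u @ ys @ xs @ v) c"
  shows "cost_bounds (u @ xs @ ys @ v) c"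
  using vanishes_swap_blocks[OF assms(1)] assms(2) trapped_swap_blocks[OF assms(1)]
  by (simp add: cost_bounds_def cost_def)

lemma cost_bounds_drop:
  assumes "\<forall>y\<in>set ys. \<bar>a - y\<bar> > 1" "\<bar>a - c\<bar> > 1" "cost_bounds (u @ ys) c"
  shows "cost_bounds (u @ a # ys) c"
  unfolding cost_bounds_def
  by (rule vanishes_drop[OF assms(1,2)], rule cost_bounds_vanishes[OF assms(3)])
    (simp add: trapped_mono attach_superset)

lemma cost_bounds_double:
  assumes "cost_bounds u c"
  shows "cost_bounds (u @ [c]) c"
  unfolding cost_bounds_def
  by (rule vanishes_double, rule cost_bounds_vanishes[OF assms]) (simp add: trapped_mono attach_superset)

text \<open>The summed exponent of \<open>vanishes_hook\<close> stays within the cost because the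
  trapped sets of \<open>b\<close> and \<open>c\<close> are disjoint and both lie in the trapped set
  of the longer word.\<close>

lemma cost_bounds_hook:
  assumes "\<bar>b - c\<bar> = 1" "b \<notin> set u" "c \<notin> set u" "cost_bounds u c" "cost_bounds u b"
  shows "cost_bounds (u @ [b]) c"
proof -
  have "cost u c + cost u b = sum wt (trapped u {c} \<union> trapped u {b})"
    unfolding cost_def using trapped_disjoint[OF assms(1-3)]
    by (intro sum.union_disjoint[symmetric]) auto
  also have "\<dots> \<le> cost (u @ [b]) c"
  proof -
    have "trapped u {c} \<union> trapped u {b} \<subseteq> trapped (u @ [b]) {c}"
      using assms(1) by (auto simp: attach_def intro: subsetD[OF trapped_mono, rotated])
    then show ?thesis
      unfolding cost_def by (intro sum_mono2) auto
  qed
  finally show ?thesis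
    using vanishes_mono[OF vanishes_hook[OF assms(1)]] assms(4,5) by (simp add: cost_bounds_def)
qed

lemma cost_bounds_sandwich:
  assumes "\<bar>b - c\<bar> = 1" "cost_bounds u c" "cost_bounds (u @ [b]) c"
  shows "cost_bounds (u @ [c, b]) c"
  unfolding cost_bounds_def
proof (rule vanishes_sandwich[OF assms(1)])
  show "vanishes u c (cost (u @ [c, b]) c)"
    by (rule cost_bounds_vanishes[OF assms(2)]) (auto simp: attach_def intro!: trapped_mono)
  show "vanishes (u @ [b]) c (cost (u @ [c, b]) c)"
    by (rule cost_bounds_vanishes[OF assms(3)]) (auto simp: attach_def intro!: trapped_mono)
qed

lemma cost_bounds_diamond:
  assumes "\<bar>b - c\<bar> = 1" "\<bar>d - c\<bar> = 1" "\<bar>b - d\<bar> > 1"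
    and "cost_bounds u c" "cost_bounds (u @ [b]) c" "cost_bounds (u @ [d]) c" "cost_bounds (u @ [d, b]) c"
  shows "cost_bounds (u @ [c, b, d]) c"
  unfolding cost_bounds_def
  by (rule vanishes_diamond[OF assms(1-3)]; rule cost_bounds_vanishes, rule assms)
    (use assms(1,2) in \<open>auto simp: attach_def intro!: trapped_mono\<close>)

lemma cost_bounds_repeated_last:
  assumes "\<bar>a - c\<bar> = 1" "cost_bounds (u @ [a]) c"
  shows "cost_bounds (u @ [a, a]) c"
  using vanishes_repeated_last[OF assms(1)] assms(2) by (simp add: cost_bounds_def cost_def)

lemma cost_bounds_repeated:
  assumes "\<bar>a - b\<bar> = 1" "\<forall>y\<in>set w. \<bar>a - y\<bar> > 1" "\<bar>a - c\<bar> > 1" "cost_bounds (u @ a # b # w) c"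
  shows "cost_bounds (u @ a # a # b # w) c"
  using vanishes_repeated[OF assms(1-3)] assms(4) by (simp add: cost_bounds_def cost_def)

text \<open>A repeated colour does not enlarge the trapped set, so \<open>b a a\<close> and
  \<open>a a b\<close> trap no more than \<open>a b a\<close>.\<close>

lemma cost_bounds_braid:
  assumes "\<bar>a - b\<bar> = 1" "cost_bounds (u @ b # a # a # w) c" "cost_bounds (u @ a # a # b # w) c"
  shows "cost_bounds (u @ a # b # a # w) c"
  unfolding cost_bounds_def
proof (rule vanishes_braid[OF assms(1)])
  show "vanishes (u @ b # a # a # w) c (cost (u @ a # b # a # w) c)"
    by (rule cost_bounds_vanishes[OF assms(2)]) (simp add: trapped_mono attach_superset)
  show "vanishes (u @ a # a # b # w) c (cost (u @ a # b # a # w) c)"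
    by (rule cost_bounds_vanishes[OF assms(3)]) (simp add: trapped_mono attach_superset attach_mono)
qed

end

section \<open>Arms and legs around the anchor\<close>

text \<open>The sign \<open>s\<close> treats the arm (\<open>s = 1\<close>) and the leg
  (\<open>s = - 1\<close>) alike. The colours approach \<open>c\<close>, which is left out, and the
  neighbour of \<open>c\<close> comes last.\<close>

fun run :: "int \<Rightarrow> int \<Rightarrow> nat \<Rightarrow> int list" where
  "run c s 0 = []"
| "run c s (Suc j) = (c + s * int (Suc j)) # run c s j"

lemma set_run: "set (run c s j) = {c + s * int k | k. 1 \<le> k \<and> k \<le> j}"
proof (induction j)
  case (Suc j)
  have "{k. 1 \<le> k \<and> k \<le> Suc j} = insert (Suc j) {k. 1 \<le> k \<and> k \<le> j}" by auto
  then show ?case using Suc by (auto simp del: of_nat_Suc)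
qed simp

lemma length_run [simp]: "length (run c s j) = j"
  by (induction j) auto

lemma run_add: "run c s (i + d) = run (c + s * int d) s i @ run c s d"
  by (induction i) (simp_all add: algebra_simps)

lemma run_Suc_snoc: "run c s (Suc j) = run (c + s) s j @ [c + s]"
  using run_add[of c s j 1] by simp

lemma run_distant:
  assumes "s = 1 \<or> s = - 1" "x \<in> set (run c s i)" "y \<in> set (run c (- s) k)"
  shows "\<bar>x - y\<bar> > 1"
  using assms by (auto simp: set_run)

section \<open>The induction over words\<close>

context klr_relations begin

text \<open>The strand \<open>c\<close> is distant from every collected colour except the last one
  of the arm and of the leg. Moving the others away leaves \<open>c c\<close>, \<open>c b c\<close>
  or a diamond in front of the suffix.\<close>

lemma cost_bounds_center:
  assumes s: "s = 1 \<or> s = - 1"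
    and IH: "\<And>u c. length u \<le> length v + j + l \<Longrightarrow> cost_bounds u c"
  shows "cost_bounds (v @ c # run c s j @ run c (- s) l) c"
proof -
  \<comment> \<open>One of arm and leg is empty; \<open>s'\<close> is the direction of the other.
    After the exchange the word ends in \<open>c (c + s')\<close>, followed by the anchor.\<close>
  have one_side: "cost_bounds (v @ c # run c s' (Suc k)) c" if "s' = 1 \<or> s' = - 1" "Suc k \<le> j + l" for s' k
  proof -
    let ?h = "run (c + s') s' k"
    have "cost_bounds ((v @ ?h) @ [c, c + s']) c"
      by (rule cost_bounds_sandwich) (use that in \<open>auto intro!: IH\<close>)
    moreover have "\<forall>x\<in>set [c]. \<forall>y\<in>set ?h. \<bar>x - y\<bar> > 1"
      using that(1) by (auto simp: set_run)
    ultimately show ?thesis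
      using cost_bounds_swap_blocks[of "[c]" ?h v "[c + s']" c] by (simp add: run_Suc_snoc del: run.simps)
  qed
  consider "j = 0" "l = 0" | k where "j = 0" "l = Suc k" | k where "j = Suc k" "l = 0"
    | j' l' where "j = Suc j'" "l = Suc l'"
    by (metis not0_implies_Suc)
  then show ?thesis
  proof cases
    case 1
    then show ?thesis
      using cost_bounds_double[of v c] IH by simp
  next
    case (2 k)
    then show ?thesis
      using one_side[of "- s" k] s by auto
  next
    case (3 k)
    then show ?thesis
      using one_side[of s k] s by auto
  next
    case (4 j' l')
    \<comment> \<open>\<open>?h\<close> and \<open>?g\<close> are arm and leg without the neighbours
      of \<open>c\<close>. The diamond is formed behind both of them; then \<open>c, c + s\<close>
      is moved left past \<open>?g\<close>, and \<open>c\<close> past \<open>?h\<close>.\<close>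
    let ?h = "run (c + s) s j'" and ?g = "run (c + - s) (- s) l'"
    have "cost_bounds ((v @ ?h @ ?g) @ [c, c + s, c + - s]) c"
      by (rule cost_bounds_diamond) (use s 4 in \<open>auto intro!: IH\<close>)
    moreover have "\<forall>x\<in>set [c, c + s]. \<forall>y\<in>set ?g. \<bar>x - y\<bar> > 1"
      using s by (auto simp: set_run)
    ultimately have "cost_bounds (v @ ?h @ [c] @ [c + s] @ ?g @ [c + - s]) c"
      using cost_bounds_swap_blocks[of "[c, c + s]" ?g "v @ ?h" "[c + - s]" c] by simp
    moreover have "\<forall>x\<in>set [c]. \<forall>y\<in>set ?h. \<bar>x - y\<bar> > 1"
      using s by (auto simp: set_run)
    ultimately have "cost_bounds (v @ [c] @ ?h @ [c + s] @ ?g @ [c + - s]) c"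
      using cost_bounds_swap_blocks[of "[c]" ?h v "[c + s] @ ?g @ [c + - s]" c] by simp
    then show ?thesis
      by (simp add: 4 run_Suc_snoc del: run.simps)
  qed
qed

text \<open>Here \<open>a\<close> is the colour just beyond the arm. Its only neighbour to the right
  is the next colour of the arm or, if the arm is empty, the anchor, once the leg has been moved out
  of the way.\<close>

lemma cost_bounds_repeated_run:
  assumes s: "s = 1 \<or> s = - 1" and a: "a = c + s * int (Suc d)"
    and cost_bounds: "cost_bounds (v @ a # run c s d @ run c (- s) l) c"
  shows "cost_bounds (v @ a # a # run c s d @ run c (- s) l) c"
proof (cases d)
  case 0
  let ?g = "run c (- s) l"
  have far: "\<forall>y\<in>set ?g. \<bar>a - y\<bar> > 1"
    using s by (auto simp: a 0 set_run)
  then have far': "\<forall>y\<in>set ?g. \<forall>x\<in>set [a]. \<bar>y - x\<bar> > 1"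
    by (simp add: abs_minus_commute)
  have "cost_bounds ((v @ ?g) @ [a]) c"
    using cost_bounds_swap_blocks[OF far', of v "[]"] cost_bounds 0 by simp
  then have "cost_bounds ((v @ ?g) @ [a, a]) c"
    using s by (intro cost_bounds_repeated_last) (auto simp: a 0)
  then show ?thesis
    using cost_bounds_swap_blocks[of "[a, a]" ?g v "[]" c] far 0 by simp
next
  case (Suc d')
  have "\<bar>a - (c + s * int (Suc d'))\<bar> = 1" "\<bar>a - c\<bar> > 1"
    "\<forall>y\<in>set (run c s d' @ run c (- s) l). \<bar>a - y\<bar> > 1"
    using s by (auto simp: a Suc set_run)
  then show ?thesis
    using cost_bounds_repeated[of a "c + s * int (Suc d')" "run c s d' @ run c (- s) l" c v] cost_bounds Suc by simp
qed

text \<open>The arm contains \<open>a\<close>, preceded by \<open>i\<close> further colours. If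
  \<open>i = 0\<close>, the word has \<open>a a\<close>; otherwise \<open>a\<close> moves right
  until \<open>a (a + s) a\<close> appears and the braid relation applies.\<close>

lemma cost_bounds_arm:
  assumes s: "s = 1 \<or> s = - 1" and a: "a = c + s * int (Suc d)" and "d < j"
    and IH: "\<And>u c. length u \<le> length v + j + l \<Longrightarrow> cost_bounds u c"
  shows "cost_bounds (v @ a # run c s j @ run c (- s) l) c"
proof -
  let ?R = "run c s d @ run c (- s) l"
  obtain i where j: "j = i + Suc d"
    using \<open>d < j\<close> less_iff_Suc_add by (metis add.commute add_Suc_right)
  have run: "run c s j = run a s i @ a # run c s d"
    using run_add[of c s i "Suc d"] by (simp add: j a)
  show ?thesis
  proof (cases i)
    case 0
    have "cost_bounds (v @ a # ?R) c"
      by (rule IH) (simp add: j)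
    then show ?thesis
      using cost_bounds_repeated_run[OF s a, of v l] by (simp add: run 0)
  next
    case (Suc i')
    let ?h = "run (a + s) s i'"
    have "cost_bounds ((v @ ?h @ [a + s]) @ a # ?R) c"
      by (rule IH) (simp add: j Suc)
    from cost_bounds_repeated_run[OF s a this] have 1: "cost_bounds ((v @ ?h) @ (a + s) # a # a # ?R) c"
      by simp
    have "cost_bounds ((v @ ?h @ [a, a]) @ (a + s) # ?R) c"
      by (rule cost_bounds_drop) (use s in \<open>auto simp: a set_run j Suc intro!: IH\<close>)
    then have 2: "cost_bounds ((v @ ?h) @ a # a # (a + s) # ?R) c"
      by simp
    have "cost_bounds (v @ ?h @ [a] @ (a + s) # a # ?R) c"
      using cost_bounds_braid[OF _ 1 2] s by auto
    then have "cost_bounds (v @ [a] @ ?h @ (a + s) # a # ?R) c"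
      by (rule cost_bounds_swap_blocks[rotated]) (use s in \<open>auto simp: set_run\<close>)
    then show ?thesis
      by (simp add: run Suc run_Suc_snoc del: run.simps)
  qed
qed

text \<open>The distance \<open>d\<close> of \<open>a\<close> from the centre on the side of the arm
  decides: 0 is the centre, up to \<open>j\<close> lies in the arm, \<open>j + 1\<close> extends it,
  and anything larger is distant from all collected strands.\<close>

lemma cost_bounds_cons_right:
  assumes s: "s = 1 \<or> s = - 1" and d: "a = c + s * int d"
    and IH: "\<And>u c. length u \<le> length v + j + l \<Longrightarrow> cost_bounds u c"
    and ext: "cost_bounds (v @ run c s (Suc j) @ run c (- s) l) c"
  shows "cost_bounds (v @ a # run c s j @ run c (- s) l) c"
proof -
  consider "d = 0" | d' where "d = Suc d'" "d' < j" | "d = Suc j" | "d > Suc j"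
    by (metis Suc_lessI less_Suc_eq linorder_neqE_nat not0_implies_Suc)
  then show ?thesis
  proof cases
    case 1
    then show ?thesis using cost_bounds_center[OF s IH, of v j l c] d by simp
  next
    case 2
    then show ?thesis using cost_bounds_arm[OF s _ _ IH] d by blast
  next
    case 3
    then show ?thesis using ext d by simp
  next
    case 4
    have "cost_bounds (v @ (run c s j @ run c (- s) l)) c"
      by (rule IH) simp
    then show ?thesis
      by (rule cost_bounds_drop[rotated 2]) (use s d 4 in \<open>auto simp: set_run\<close>)
  qed
qed

text \<open>\<open>v\<close> is consumed from the right while arm and leg grow, with shorter words
  settled. Once \<open>v\<close> is empty all colours are distinct, so
  \<open>cost_bounds_hook\<close> splits off a neighbour of the anchor; the anchor alone is the
  cyclotomic relation.\<close>

lemma cost_bounds_step: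
  assumes s: "s = 1 \<or> s = - 1"
    and "\<And>u c. length u < length v + j + l \<Longrightarrow> cost_bounds u c"
  shows "cost_bounds (v @ run c s j @ run c (- s) l) c"
  using assms
proof (induction v arbitrary: s j l rule: rev_induct)
  case Nil
  show ?case
  proof (cases l)
    case (Suc l')
    have "cost_bounds ((run c s j @ run (c + - s) (- s) l') @ [c + - s]) c"
      by (rule cost_bounds_hook) (use Nil in \<open>auto simp: Suc set_run\<close>)
    then show ?thesis
      by (simp add: Suc run_Suc_snoc del: run.simps)
  next
    case l: 0
    show ?thesis
    proof (cases j)
      case 0
      then show ?thesis
        using cyclotomic by (simp add: l cost_bounds_def vanishes_def cost_def)
    next
      case (Suc j')
      have "cost_bounds (run (c + s) s j' @ [c + s]) c"
        by (rule cost_bounds_hook) (use Nil in \<open>auto simp: Suc set_run\<close>)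
      then show ?thesis
        by (simp add: Suc l run_Suc_snoc del: run.simps(2))
    qed
  qed
next
  case (snoc a v)
  have IH: "cost_bounds u c" if "length u \<le> length v + j + l" for u c
    using that by (intro snoc.prems(2)) simp
  have IH': "cost_bounds u c" if "length u \<le> length v + l + j" for u c
    using that by (intro IH) simp
  \<comment> \<open>The total length is unchanged: the strand taken from \<open>v\<close> is
    replaced by an extension of the arm or of the leg.\<close>
  have ext: "cost_bounds (v @ run c s (Suc j) @ run c (- s) l) c"
    "cost_bounds (v @ run c (- s) (Suc l) @ run c (- (- s)) j) c"
    by (rule snoc.IH; use snoc.prems in auto)+
  show ?case
  proof (cases "s * (a - c) \<ge> 0")
    case True
    then have a: "a = c + s * int (nat (s * (a - c)))"
      using snoc.prems(1) by auto
    from cost_bounds_cons_right[OF snoc.prems(1) a IH ext(1)] show ?thesis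
      by simp
  next
    case False
    then have a: "a = c + - s * int (nat (- s * (a - c)))"
      using snoc.prems(1) by auto
    have "- s = 1 \<or> - s = - 1"
      using snoc.prems(1) by auto
    \<comment> \<open>With the opposite sign arm and leg change roles; being distant from each
      other, they can be swapped back afterwards.\<close>
    from cost_bounds_cons_right[OF this a IH' ext(2)]
    have "cost_bounds ((v @ [a]) @ run c (- s) l @ run c s j @ []) c"
      by simp
    then have "cost_bounds ((v @ [a]) @ run c s j @ run c (- s) l @ []) c"
      by (rule cost_bounds_swap_blocks[rotated]) (use run_distant[OF snoc.prems(1)] in blast)
    then show ?thesis
      by simp
  qed
qed

lemma cost_bounds_all: "cost_bounds u c"
proof (induction u arbitrary: c rule: length_induct)
  case (1 u)
  then show ?case
    using cost_bounds_step[of 1 u 0 0 c] by simp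
qed

end

section \<open>The cyclotomic quotient satisfies the local relations\<close>

text \<open>
  A type cannot depend on \<open>\<Lambda>\<close> and \<open>\<nu>\<close>, so the quotients for all \<open>\<Lambda>\<close> and \<open>\<nu>\<close> are embedded into
  their product, which is an instance of the type classes of rings.
\<close>

typedef (overloaded) 'k cyc_family =
  "{f :: int multiset \<times> int multiset \<Rightarrow> 'k::field klr_free set set.
    \<forall>p. f p \<in> carrier (cyc_klr (fst p) (snd p))}"
proof -
  have "\<zero>\<^bsub>cyc_klr \<Lambda> \<nu>\<^esub> \<in> carrier (cyc_klr \<Lambda> \<nu> :: 'k klr_free set set ring)" for \<Lambda> \<nu>
    by (rule ring.ring_simprules(2)[OF ring_cyc_klr])
  then show ?thesis
    by (intro exI[of _ "\<lambda>p. \<zero>\<^bsub>cyc_klr (fst p) (snd p)\<^esub>"]) simp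
qed

setup_lifting type_definition_cyc_family

instantiation cyc_family :: (field) "{ring, monoid_mult}"
begin

lift_definition zero_cyc_family :: "'a cyc_family"
  is "\<lambda>p. \<zero>\<^bsub>cyc_klr (fst p) (snd p)\<^esub>"
  by (rule ring.ring_simprules(2)[OF ring_cyc_klr])

lift_definition one_cyc_family :: "'a cyc_family"
  is "\<lambda>p. \<one>\<^bsub>cyc_klr (fst p) (snd p)\<^esub>"
  by (rule ring.ring_simprules(6)[OF ring_cyc_klr])

lift_definition plus_cyc_family :: "'a cyc_family \<Rightarrow> 'a cyc_family \<Rightarrow> 'a cyc_family"
  is "\<lambda>f g p. f p \<oplus>\<^bsub>cyc_klr (fst p) (snd p)\<^esub> g p"
  by (rule ring.ring_simprules(1)[OF ring_cyc_klr]) auto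

lift_definition times_cyc_family :: "'a cyc_family \<Rightarrow> 'a cyc_family \<Rightarrow> 'a cyc_family"
  is "\<lambda>f g p. f p \<otimes>\<^bsub>cyc_klr (fst p) (snd p)\<^esub> g p"
  by (rule ring.ring_simprules(5)[OF ring_cyc_klr]) auto

lift_definition uminus_cyc_family :: "'a cyc_family \<Rightarrow> 'a cyc_family"
  is "\<lambda>f p. \<ominus>\<^bsub>cyc_klr (fst p) (snd p)\<^esub> f p"
  by (rule ring.ring_simprules(3)[OF ring_cyc_klr]) auto

lift_definition minus_cyc_family :: "'a cyc_family \<Rightarrow> 'a cyc_family \<Rightarrow> 'a cyc_family"
  is "\<lambda>f g p. f p \<ominus>\<^bsub>cyc_klr (fst p) (snd p)\<^esub> g p"
  by (rule ring.ring_simprules(4)[OF ring_cyc_klr]) auto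

instance
proof
  fix a b c :: "'a cyc_family"
  note R = ring.ring_simprules[OF ring_cyc_klr] Group.monoid.r_one[OF ring.is_monoid[OF ring_cyc_klr]]
  show "a + b + c = a + (b + c)" by transfer (auto simp: R fun_eq_iff)
  show "a + b = b + a" by transfer (auto simp: R fun_eq_iff)
  show "0 + a = a" by transfer (auto simp: R fun_eq_iff)
  show "- a + a = 0" by transfer (auto simp: R fun_eq_iff)
  show "a - b = a + - b" by transfer (auto simp: R fun_eq_iff)
  show "a * b * c = a * (b * c)" by transfer (auto simp: R fun_eq_iff)
  show "(a + b) * c = a * c + b * c" by transfer (auto simp: R fun_eq_iff)
  show "a * (b + c) = a * b + a * c" by transfer (auto simp: R fun_eq_iff)
  show "1 * a = a" by transfer (auto simp: R fun_eq_iff)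
  show "a * 1 = a" by transfer (auto simp: R fun_eq_iff)
qed

end

text \<open>The inclusion of one factor into the product. It respects sums and products on the
  carrier but not the unit, hence the positive exponent in \<open>single_power\<close>. Arguments
  outside the carrier get the default value 0.\<close>

lift_definition single :: "int multiset \<Rightarrow> int multiset \<Rightarrow> 'k::field klr_free set set \<Rightarrow> 'k cyc_family"
  is "\<lambda>\<Lambda> \<nu> a p. if p = (\<Lambda>, \<nu>) \<and> a \<in> carrier (cyc_klr \<Lambda> \<nu>) then a else \<zero>\<^bsub>cyc_klr (fst p) (snd p)\<^esub>"
  by (auto intro: ring.ring_simprules(2)[OF ring_cyc_klr])

lemma single_hom:
  assumes "a \<in> carrier (cyc_klr \<Lambda> \<nu>)" "b \<in> carrier (cyc_klr \<Lambda> \<nu>)"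
  shows "single \<Lambda> \<nu> (a \<oplus>\<^bsub>cyc_klr \<Lambda> \<nu>\<^esub> b) = single \<Lambda> \<nu> a + single \<Lambda> \<nu> b"
    and "single \<Lambda> \<nu> (a \<otimes>\<^bsub>cyc_klr \<Lambda> \<nu>\<^esub> b) = single \<Lambda> \<nu> a * single \<Lambda> \<nu> b"
proof -
  note R = ring.ring_simprules[OF ring_cyc_klr]
  show "single \<Lambda> \<nu> (a \<oplus>\<^bsub>cyc_klr \<Lambda> \<nu>\<^esub> b) = single \<Lambda> \<nu> a + single \<Lambda> \<nu> b"
    using assms by transfer (auto simp: R fun_eq_iff)
  show "single \<Lambda> \<nu> (a \<otimes>\<^bsub>cyc_klr \<Lambda> \<nu>\<^esub> b) = single \<Lambda> \<nu> a * single \<Lambda> \<nu> b"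
    using assms by transfer (auto simp: R fun_eq_iff)
qed

lemma single_zero [simp]: "single \<Lambda> \<nu> \<zero>\<^bsub>cyc_klr \<Lambda> \<nu>\<^esub> = 0"
  by transfer (auto simp: fun_eq_iff)

lemma single_eq_0_iff:
  "a \<in> carrier (cyc_klr \<Lambda> \<nu>) \<Longrightarrow> single \<Lambda> \<nu> a = 0 \<longleftrightarrow> a = \<zero>\<^bsub>cyc_klr \<Lambda> \<nu>\<^esub>"
  by transfer (auto simp: fun_eq_iff)

lemma single_power:
  assumes "a \<in> carrier (cyc_klr \<Lambda> \<nu>)" "0 < n"
  shows "single \<Lambda> \<nu> (a [^]\<^bsub>cyc_klr \<Lambda> \<nu>\<^esub> n) = single \<Lambda> \<nu> a ^ n"
  using assms(2)
proof (induction n rule: nat_induct_non_zero)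
  case (Suc n)
  interpret ring "cyc_klr \<Lambda> \<nu>" by (rule ring_cyc_klr)
  show ?case
    using Suc assms(1) by (simp add: single_hom power_commutes)
qed (use assms(1) in \<open>simp add: ring.ring_simprules[OF ring_cyc_klr] Group.monoid.nat_pow_Suc ring.is_monoid ring_cyc_klr\<close>)

section \<open>Images of the generators and their relations\<close>

lemma swp_append: "swp (Suc (length u)) (u @ a # b # t) = u @ b # a # t"
  by (simp add: swp_def col_def nth_append list_update_append)

lemma cartan_simps:
  "cartan a b = 0 \<longleftrightarrow> \<bar>a - b\<bar> > 1" "cartan a b = - 1 \<longleftrightarrow> \<bar>a - b\<bar> = 1"
  by (auto simp: cartan_def)

lemma klr_rel_carrier:
  fixes a b :: "'k::field klr_free"
  assumes "klr_rel \<nu> a b"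
  shows "a \<in> carrier (free_algebra (klr_gens \<nu>))" "b \<in> carrier (free_algebra (klr_gens \<nu>))"
  using assms
  by (cases; simp add: free_algebra_closed free_algebra_sum_closed klr_gens_intros swp_Seq
        del: free_algebra_simps(1))+

context
  fixes \<Lambda> \<nu> :: "int multiset"
begin

definition cyc_image :: "'k::field klr_free \<Rightarrow> 'k cyc_family" where
  "cyc_image f = single \<Lambda> \<nu> (cyc_ideal \<Lambda> \<nu> +>\<^bsub>klr \<nu>\<^esub> (klr_ideal \<nu> +>\<^bsub>free_algebra (klr_gens \<nu>)\<^esub> f))"

lemma klr_hom: "(+>\<^bsub>free_algebra (klr_gens \<nu>)\<^esub>) (klr_ideal \<nu>) \<in> ring_hom (free_algebra (klr_gens \<nu>)) (klr \<nu>)"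
  unfolding klr_def by (rule ideal.rcos_ring_hom[OF ideal_klr_ideal])

lemma cyc_hom: "(+>\<^bsub>klr \<nu>\<^esub>) (cyc_ideal \<Lambda> \<nu>) \<in> ring_hom (klr \<nu>) (cyc_klr \<Lambda> \<nu>)"
  unfolding cyc_klr_def by (rule ideal.rcos_ring_hom[OF ideal_cyc_ideal])

lemma cyc_image_hom:
  fixes f g :: "'k::field klr_free"
  assumes "f \<in> carrier (free_algebra (klr_gens \<nu>))" "g \<in> carrier (free_algebra (klr_gens \<nu>))"
  shows "cyc_image (f + g) = cyc_image f + cyc_image g" and "cyc_image (f * g) = cyc_image f * cyc_image g"
    and "cyc_image (f - g) = cyc_image f - cyc_image g"
proof -
  note h = ring_hom_trans[OF klr_hom cyc_hom]
  have add: "cyc_image (f + g) = cyc_image f + cyc_image g" if "f \<in> carrier (free_algebra (klr_gens \<nu>))"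
      "g \<in> carrier (free_algebra (klr_gens \<nu>))" for f g :: "'k::field klr_free"
    using that single_hom(1)[OF ring_hom_closed[OF h] ring_hom_closed[OF h]] ring_hom_add[OF h that]
    by (simp add: cyc_image_def del: free_algebra_simps(1))
  show "cyc_image (f + g) = cyc_image f + cyc_image g"
    by (rule add[OF assms])
  show "cyc_image (f * g) = cyc_image f * cyc_image g"
    using assms single_hom(2)[OF ring_hom_closed[OF h] ring_hom_closed[OF h]] ring_hom_mult[OF h assms]
    by (simp add: cyc_image_def del: free_algebra_simps(1))
  show "cyc_image (f - g) = cyc_image f - cyc_image g"
    using add[OF free_algebra_closed(2)[OF assms] assms(2)] by simp
qed

lemma cyc_image_0 [simp]: "cyc_image 0 = 0"
  using cyc_image_hom(1)[of 0 0] by (simp add: free_algebra_closed)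

lemma cyc_image_rel:
  fixes a b :: "'k::field klr_free"
  assumes "klr_rel \<nu> a b"
  shows "cyc_image a = cyc_image b"
proof -
  let ?F = "free_algebra (klr_gens \<nu>) :: 'k klr_free ring"
  have "a - b \<in> klr_ideal \<nu>"
    unfolding klr_ideal_def
    by (rule subsetD[OF ring.genideal_self[OF ring_free_algebra klr_relators_subset]])
      (use assms in \<open>auto simp: klr_relators_def\<close>)
  then have "klr_ideal \<nu> +>\<^bsub>?F\<^esub> (a - b) = \<zero>\<^bsub>klr \<nu>\<^esub>"
    using ring.a_rcos_zero[OF ring_free_algebra ideal_klr_ideal] by (auto simp: klr_def FactRing_def)
  moreover have "cyc_ideal \<Lambda> \<nu> +>\<^bsub>klr \<nu>\<^esub> (\<zero>\<^bsub>klr \<nu>\<^esub> :: 'k klr_free set) = \<zero>\<^bsub>cyc_klr \<Lambda> \<nu>\<^esub>"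
    by (rule ring_hom_zero[OF cyc_hom ring_klr ring_cyc_klr])
  ultimately have "cyc_image (a - b) = 0"
    by (simp add: cyc_image_def)
  then show ?thesis
    using cyc_image_hom(3)[OF klr_rel_carrier[OF assms]] by simp
qed

definition E :: "int list \<Rightarrow> 'k::field cyc_family" where
  "E w = (if w \<in> Seq \<nu> then cyc_image (e_gen w) else 0)"

text \<open>Strand \<open>k\<close>, counted from 0, carries the generator number
  \<open>Suc k\<close>. Words or positions out of range get 0.\<close>

definition dot :: "nat \<Rightarrow> int list \<Rightarrow> 'k::field cyc_family" where
  "dot k w = (if w \<in> Seq \<nu> \<and> k < size \<nu> then cyc_image (x_gen (Suc k) w) else 0)"

definition crossing :: "nat \<Rightarrow> int list \<Rightarrow> 'k::field cyc_family" where
  "crossing k w = (if w \<in> Seq \<nu> \<and> Suc k < size \<nu> then cyc_image (d_gen (Suc k) w) else 0)"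

definition total_dot :: "nat \<Rightarrow> 'k::field cyc_family" where
  "total_dot k = (\<Sum>w\<in>Seq \<nu>. dot k w)"

definition total_crossing :: "nat \<Rightarrow> 'k::field cyc_family" where
  "total_crossing k = (\<Sum>w\<in>Seq \<nu>. crossing k w)"

lemma gens_carrier:
  "w \<in> Seq \<nu> \<Longrightarrow> e_gen w \<in> carrier (free_algebra (klr_gens \<nu>))"
  "w \<in> Seq \<nu> \<Longrightarrow> k < size \<nu> \<Longrightarrow> x_gen (Suc k) w \<in> carrier (free_algebra (klr_gens \<nu>))"
  "w \<in> Seq \<nu> \<Longrightarrow> Suc k < size \<nu> \<Longrightarrow> d_gen (Suc k) w \<in> carrier (free_algebra (klr_gens \<nu>))"
  by (simp_all add: free_algebra_closed klr_gens_intros del: free_algebra_simps(1))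

lemmas cyc_image_simps = cyc_image_hom gens_carrier free_algebra_closed swp_Seq

lemma E_E: "E w * E v = (if w = v then E w else 0)"
  using cyc_image_rel[OF klr_rel.idem, of w] cyc_image_rel[OF klr_rel.orth, of w v]
  by (auto simp: E_def cyc_image_simps simp del: free_algebra_simps(1))

lemma dot_E: "E w * dot k v = (if w = v then dot k v else 0)" "dot k v * E w = (if w = v then dot k v else 0)"
proof -
  have d: "dot k v = E v * dot k v * E v"
    using cyc_image_rel[OF klr_rel.dot_idem, of v "Suc k"]
    by (auto simp: E_def dot_def cyc_image_simps simp del: free_algebra_simps(1))
  show "E w * dot k v = (if w = v then dot k v else 0)"
    by (subst (1 2) d) (simp add: mult.assoc[symmetric] E_E)
  show "dot k v * E w = (if w = v then dot k v else 0)"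
    by (subst (1 2) d) (simp add: mult.assoc E_E)
qed

lemma crossing_E: 
  "E w * crossing k v = (if w = swp (Suc k) v then crossing k v else 0)"
  "crossing k v * E w = (if w = v then crossing k v else 0)"
proof -
  have d: "crossing k v = E (swp (Suc k) v) * crossing k v * E v"
    using cyc_image_rel[OF klr_rel.cross_idem, of v "Suc k"]
    by (auto simp: E_def crossing_def cyc_image_simps simp del: free_algebra_simps(1))
  show "E w * crossing k v = (if w = swp (Suc k) v then crossing k v else 0)"
    by (subst (1 2) d) (simp add: mult.assoc[symmetric] E_E)
  show "crossing k v * E w = (if w = v then crossing k v else 0)"
    by (subst (1 2) d) (simp add: mult.assoc E_E)
qed

lemma total_dot_E: "total_dot k * E w = dot k w" "E w * total_dot k = dot k w"
  by (simp_all add: total_dot_def sum_distrib_left sum_distrib_right dot_E finite_Seq)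
    (simp_all add: dot_def)

lemma total_crossing_E: "total_crossing k * E w = crossing k w"
  by (simp add: total_crossing_def sum_distrib_right crossing_E finite_Seq)
    (simp add: crossing_def)

text \<open>The idempotent at the top of the right factor selects one summand of the total
  operator.\<close>

lemma total_strand:
  fixes z :: "'k::field cyc_family"
  shows "total_dot k * dot j w = (dot k w * dot j w :: 'k cyc_family)"
    and "total_dot k * crossing j w = (dot k (swp (Suc j) w) * crossing j w :: 'k cyc_family)"
    and "total_crossing k * dot j w = (crossing k w * dot j w :: 'k cyc_family)"
    and "total_crossing k * crossing j w = (crossing k (swp (Suc j) w) * crossing j w :: 'k cyc_family)"
    and "total_crossing k * (crossing j w * z) = crossing k (swp (Suc j) w) * (crossing j w * z)"
proof -
  have 1: "a * dot j w = a * E w * dot j w" "a * crossing j w = a * E (swp (Suc j) w) * crossing j w"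
    for a :: "'k cyc_family"
    by (simp_all add: mult.assoc dot_E crossing_E)
  show "total_dot k * dot j w = (dot k w * dot j w :: 'k cyc_family)"
    "total_dot k * crossing j w = (dot k (swp (Suc j) w) * crossing j w :: 'k cyc_family)"
    "total_crossing k * dot j w = (crossing k w * dot j w :: 'k cyc_family)"
    and X: "total_crossing k * crossing j w = (crossing k (swp (Suc j) w) * crossing j w :: 'k cyc_family)"
    by (simp_all only: 1[of "total_dot k"] 1[of "total_crossing k"] total_dot_E total_crossing_E)
  show "total_crossing k * (crossing j w * z) = crossing k (swp (Suc j) w) * (crossing j w * z)"
    by (simp add: X flip: mult.assoc)
qed

lemmas to_strands = mult.assoc total_crossing_E total_dot_E(1) total_strand

lemma Seq_append_less:
  assumes "u @ a # b # t \<in> Seq \<nu>"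
  shows "Suc (length u) < size \<nu>"
  using length_Seq[OF assms] by simp

text \<open>Exchanging two letters is an involution on words of the right length, so exactly one
  summand has the given word at its top.\<close>

lemma E_total_crossing:
  "E (u @ b # a # t) * total_crossing (length u) = crossing (length u) (u @ a # b # t)"
proof (cases "u @ a # b # t \<in> Seq \<nu>")
  case True
  have iff: "u @ b # a # t = swp (Suc (length u)) w \<longleftrightarrow> w = u @ a # b # t" if "w \<in> Seq \<nu>" for w
  proof
    assume eq: "u @ b # a # t = swp (Suc (length u)) w"
    have "length w = length (u @ a # b # t)"
      using length_Seq[OF that] length_Seq[OF True] by simp
    then have "swp (Suc (length u)) (swp (Suc (length u)) w) = w"
      by (auto simp: swp_def col_def list_eq_iff_nth_eq nth_list_update)
    then show "w = u @ a # b # t"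
      using eq by (metis swp_append)
  qed (simp add: swp_append)
  have "E (u @ b # a # t) * total_crossing (length u)
      = (\<Sum>w\<in>Seq \<nu>. if w = u @ a # b # t then crossing (length u) w else 0)"
    unfolding total_crossing_def sum_distrib_left by (rule sum.cong) (auto simp: crossing_E iff)
  then show ?thesis
    using True by (simp add: finite_Seq)
next
  case False
  then have "u @ b # a # t \<notin> Seq \<nu>"
    by (simp add: Seq_iff add_mset_commute)
  then show ?thesis
    using False by (simp add: E_def crossing_def)
qed

text \<open>At exponent 0 both sides are the idempotent of \<open>w\<close>, which is the convention
  for the zeroth power of a dot. At positive exponents only the summand at \<open>w\<close>
  survives.\<close>

lemma E_power_corner:
  assumes "w \<in> Seq \<nu>" "k < size \<nu>"
  shows "(total_dot k ^ n * E w :: 'k::field cyc_family) =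
    single \<Lambda> \<nu> (corner_pow (cyc_klr \<Lambda> \<nu>) (cyc_e \<Lambda> \<nu> w) (cyc_x \<Lambda> \<nu> (Suc k) w) n)"
proof (cases "n = 0")
  case True
  then show ?thesis
    using assms by (simp add: E_def cyc_image_def corner_pow_def cyc_e_def klr_e_def)
next
  case False
  then have n: "0 < n" by simp
  have "total_dot k ^ n * E w = (dot k w ^ n :: 'k cyc_family)"
    using n
  proof (induction n rule: nat_induct_non_zero)
    case (Suc n)
    have "total_dot k ^ Suc n * E w = (total_dot k * dot k w ^ n :: 'k cyc_family)"
      using Suc by (simp add: mult.assoc)
    also have "\<dots> = dot k w ^ Suc n"
      using Suc.hyps by (cases n) (simp_all add: total_strand flip: mult.assoc)
    finally show ?case .
  qed (simp add: total_dot_E)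
  moreover have "cyc_x \<Lambda> \<nu> (Suc k) w \<in> carrier (cyc_klr \<Lambda> \<nu> :: 'k klr_free set set ring)"
    unfolding cyc_x_def by (rule ring_hom_closed[OF cyc_hom klr_x_carrier]) (use assms in auto)
  ultimately show ?thesis
    using assms n by (simp add: corner_pow_def single_power dot_def cyc_image_def cyc_x_def klr_x_def)
qed

lemma corner_pow_cyc:
  assumes "w \<in> Seq \<nu>" "k < size \<nu>"
  shows "corner_pow (cyc_klr \<Lambda> \<nu>) (cyc_e \<Lambda> \<nu> w) (cyc_x \<Lambda> \<nu> (Suc k) w) n =
    cyc_ideal \<Lambda> \<nu> +>\<^bsub>klr \<nu>\<^esub> corner_pow (klr \<nu>) (klr_e \<nu> w) (klr_x \<nu> (Suc k) w :: 'k::field klr_free set) n"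
proof -
  interpret h: ring_hom_ring "klr \<nu> :: 'k klr_free set ring" "cyc_klr \<Lambda> \<nu>" "(+>\<^bsub>klr \<nu>\<^esub>) (cyc_ideal \<Lambda> \<nu>)"
    by (rule ring_hom_ringI2[OF ring_klr ring_cyc_klr cyc_hom])
  show ?thesis
    using h.hom_nat_pow[OF klr_x_carrier[of w \<nu> "Suc k"]] assms
    by (simp add: corner_pow_def cyc_e_def cyc_x_def)
qed

text \<open>\<open>to_strands\<close> reduces each claim to single generators, where it is the image
  of a defining relation; for words outside \<open>Seq \<nu>\<close> both sides are 0.\<close>

lemma klr_relations: "klr_relations E total_dot (total_crossing :: nat \<Rightarrow> 'k::field cyc_family) (count \<Lambda>)"
proof
  fix p q :: nat
  have "dot p w * dot q w = (dot q w * dot p w :: 'k cyc_family)" for w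
    using cyc_image_rel[where 'k = 'k, OF klr_rel.dot_dot, of w "Suc p" "Suc q"]
    by (auto simp: dot_def cyc_image_simps simp del: free_algebra_simps(1))
  moreover have "total_dot p * total_dot q = (\<Sum>w\<in>Seq \<nu>. dot p w * dot q w :: 'k cyc_family)" for p q
    unfolding total_dot_def[of q] sum_distrib_left by (simp add: to_strands)
  ultimately show "total_dot p * total_dot q = (total_dot q * total_dot p :: 'k cyc_family)"
    by simp
next
  fix w p
  show "E w * total_dot p = (total_dot p * E w :: 'k cyc_family)"
    by (simp add: total_dot_E)
next
  fix u t :: "int list" and a b :: int
  let ?w = "u @ a # b # t"
  show "total_crossing (length u) * E ?w = (E (u @ b # a # t) * total_crossing (length u) :: 'k cyc_family)"
    by (simp add: E_total_crossing total_crossing_E)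
next
  fix u t :: "int list" and a b :: int and p
  let ?w = "u @ a # b # t"
  assume "p \<noteq> length u" "p \<noteq> Suc (length u)"
  then show "total_dot p * total_crossing (length u) * E ?w =
      (total_crossing (length u) * total_dot p * E ?w :: 'k cyc_family)"
    using cyc_image_rel[where 'k = 'k, OF klr_rel.cross_dot_far, of ?w "Suc (length u)" "Suc p"] Seq_append_less[of u a b t]
    by (simp add: to_strands) (auto simp: crossing_def dot_def cyc_image_simps simp del: free_algebra_simps(1))
next
  fix u t :: "int list" and a :: int
  let ?w = "u @ a # a # t"
  show "total_crossing (length u) * total_crossing (length u) * E ?w = (0 :: 'k cyc_family)"
    using cyc_image_rel[where 'k = 'k, OF klr_rel.cross_cross_same, of ?w "Suc (length u)"] Seq_append_less[of u a a t]
    by (simp add: to_strands) (auto simp: crossing_def cyc_image_simps col_def nth_append simp del: free_algebra_simps(1))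
next
  fix u t :: "int list" and a b :: int
  let ?w = "u @ a # b # t"
  assume "\<bar>a - b\<bar> > 1"
  then show "total_crossing (length u) * total_crossing (length u) * E ?w = (E ?w :: 'k cyc_family)"
    using cyc_image_rel[where 'k = 'k, OF klr_rel.cross_cross_distant, of ?w "Suc (length u)"] Seq_append_less[of u a b t]
    by (simp add: to_strands)
      (auto simp: E_def crossing_def cyc_image_simps col_def nth_append cartan_simps simp del: free_algebra_simps(1))
next
  fix u t :: "int list" and a b :: int
  let ?w = "u @ a # b # t"
  assume "\<bar>a - b\<bar> = 1"
  then show "total_crossing (length u) * total_crossing (length u) * E ?w =
      ((total_dot (length u) + total_dot (Suc (length u))) * E ?w :: 'k cyc_family)"
    using cyc_image_rel[where 'k = 'k, OF klr_rel.cross_cross_adjacent, of ?w "Suc (length u)"] Seq_append_less[of u a b t]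
    by (simp add: to_strands distrib_right)
      (auto simp: dot_def crossing_def cyc_image_simps col_def nth_append cartan_simps simp del: free_algebra_simps(1))
next
  fix u t :: "int list" and a b :: int
  let ?w = "u @ a # b # t"
  assume "a \<noteq> b"
  then show "total_dot (length u) * total_crossing (length u) * E ?w =
      (total_crossing (length u) * total_dot (Suc (length u)) * E ?w :: 'k cyc_family)"
    using cyc_image_rel[where 'k = 'k, OF klr_rel.slide_left, of ?w "Suc (length u)"] Seq_append_less[of u a b t]
    by (simp add: to_strands)
      (auto simp: dot_def crossing_def cyc_image_simps col_def nth_append simp del: free_algebra_simps(1))
next
  fix u t :: "int list" and a b :: int
  let ?w = "u @ a # b # t"
  assume "a \<noteq> b"
  then show "total_dot (Suc (length u)) * total_crossing (length u) * E ?w =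
      (total_crossing (length u) * total_dot (length u) * E ?w :: 'k cyc_family)"
    using cyc_image_rel[where 'k = 'k, OF klr_rel.slide_right, of ?w "Suc (length u)"] Seq_append_less[of u a b t]
    by (simp add: to_strands)
      (auto simp: dot_def crossing_def cyc_image_simps col_def nth_append simp del: free_algebra_simps(1))
next
  fix u t :: "int list" and a :: int
  let ?w = "u @ a # a # t"
  show "total_dot (length u) * total_crossing (length u) * E ?w =
      (total_crossing (length u) * total_dot (Suc (length u)) * E ?w + E ?w :: 'k cyc_family)"
    using cyc_image_rel[where 'k = 'k, OF klr_rel.nil_left, of ?w "Suc (length u)"] Seq_append_less[of u a a t]
    by (simp add: to_strands swp_append) (auto simp: E_def dot_def crossing_def cyc_image_simps col_def nth_append
      diff_eq_eq add.commute simp del: free_algebra_simps(1))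
next
  fix u t :: "int list" and a :: int
  let ?w = "u @ a # a # t"
  show "total_crossing (length u) * total_dot (length u) * E ?w =
      (total_dot (Suc (length u)) * total_crossing (length u) * E ?w + E ?w :: 'k cyc_family)"
    using cyc_image_rel[where 'k = 'k, OF klr_rel.nil_right, of ?w "Suc (length u)"] Seq_append_less[of u a a t]
    by (simp add: to_strands swp_append) (auto simp: E_def dot_def crossing_def cyc_image_simps col_def nth_append
      diff_eq_eq add.commute simp del: free_algebra_simps(1))
next
  fix u t :: "int list" and a b :: int
  let ?w = "u @ a # b # a # t" and ?k = "length u"
  assume ab: "\<bar>a - b\<bar> = 1"
  show "(E ?w :: 'k cyc_family) =
      total_crossing ?k * total_crossing (Suc ?k) * total_crossing ?k * E ?w -
      total_crossing (Suc ?k) * total_crossing ?k * total_crossing (Suc ?k) * E ?w"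
  proof (cases "?w \<in> Seq \<nu>")
    case True
    then have l: "Suc (Suc ?k) < size \<nu>"
      using length_Seq by fastforce
    have "klr_rel \<nu>
        (d_gen (Suc ?k) (swp (Suc (Suc ?k)) (swp (Suc ?k) ?w)) * d_gen (Suc (Suc ?k)) (swp (Suc ?k) ?w) *
         d_gen (Suc ?k) ?w -
         d_gen (Suc (Suc ?k)) (swp (Suc ?k) (swp (Suc (Suc ?k)) ?w)) * d_gen (Suc ?k) (swp (Suc (Suc ?k)) ?w) *
         d_gen (Suc (Suc ?k)) ?w)
        (e_gen ?w :: 'k klr_free)"
      using klr_rel.braid[OF True, of "Suc ?k", where 'k = 'k] l ab
      by (simp add: col_def nth_append cartan_simps)
    from cyc_image_rel[where 'k = 'k, OF this] show ?thesis
      using True l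
      by (simp add: to_strands)
        (simp add: E_def crossing_def cyc_image_simps mult.assoc del: free_algebra_simps(1))
  qed (simp add: E_def)
next
  fix a :: int and t :: "int list"
  let ?w = "a # t"
  show "total_dot 0 ^ count \<Lambda> a * E ?w = (0 :: 'k cyc_family)"
  proof (cases "?w \<in> Seq \<nu>")
    case True
    then have l: "0 < size \<nu>"
      using length_Seq by fastforce
    have "corner_pow (klr \<nu>) (klr_e \<nu> ?w) (klr_x \<nu> (Suc 0) ?w) (count \<Lambda> a) \<in>
        (cyc_gens \<Lambda> \<nu> :: 'k klr_free set set)"
      unfolding cyc_gens_def using True by (force simp: col_def)
    then have "corner_pow (klr \<nu>) (klr_e \<nu> ?w) (klr_x \<nu> (Suc 0) ?w) (count \<Lambda> a) \<in>
        (cyc_ideal \<Lambda> \<nu> :: 'k klr_free set set)"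
      unfolding cyc_ideal_def by (rule subsetD[OF ring.genideal_self[OF ring_klr cyc_gens_subset]])
    then have "cyc_ideal \<Lambda> \<nu> +>\<^bsub>klr \<nu>\<^esub> corner_pow (klr \<nu>) (klr_e \<nu> ?w) (klr_x \<nu> (Suc 0) ?w) (count \<Lambda> a) =
        (\<zero>\<^bsub>cyc_klr \<Lambda> \<nu>\<^esub> :: 'k klr_free set set)"
      using ring.a_rcos_zero[OF ring_klr ideal_cyc_ideal] by (auto simp: cyc_klr_def FactRing_def)
    then show ?thesis
      by (simp add: E_power_corner[OF True l] corner_pow_cyc[OF True l])
  qed (simp add: E_def)
qed

end

section \<open>Comparison with the antigravity configuration and conclusion\<close>

text \<open>Going down through the suffixes of \<open>u\<close>, a newly attached colour is equal or
  adjacent to that of a remaining bead with a larger number. That bead blocks the new one, which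
  prolongs the chain to the anchor by one step.\<close>

lemma trapped_antigravity:
  assumes "j \<in> trapped (drop i u) {c}" "i \<le> length u"
  shows "\<exists>k>i. k \<le> Suc (length u) \<and> col (u @ c # t) k = j \<and> remains (u @ c # t) (Suc (length u)) k"
  using assms
proof (induction "length u - i" arbitrary: i j)
  case 0
  then show ?case
    by (auto simp: remains_def col_def intro!: exI[of _ "Suc (length u)"])
next
  case (Suc n)
  let ?w = "u @ c # t"
  from Suc.hyps(2) have i: "i < length u" by simp
  have "n = length u - Suc i" "Suc i \<le> length u"
    using Suc.hyps(2) by simp_all
  note IH = Suc.hyps(1)[OF this(1) _ this(2)]
  have "drop i u = u ! i # drop (Suc i) u"
    using i by (simp add: Cons_nth_drop_Suc)
  then have "j \<in> attach (u ! i) (trapped (drop (Suc i) u) {c})"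
    using Suc.prems(1) by simp
  then consider "j \<in> trapped (drop (Suc i) u) {c}"
    | x where "j = u ! i" "x \<in> trapped (drop (Suc i) u) {c}" "\<bar>u ! i - x\<bar> \<le> 1"
    by (auto simp: attach_def split: if_splits)
  then show ?case
  proof cases
    case 1
    then obtain k where "k > Suc i" "k \<le> Suc (length u)" "col ?w k = j" "remains ?w (Suc (length u)) k"
      using IH by blast
    then show ?thesis
      by (intro exI[of _ k]) simp
  next
    case 2
    then obtain k where k: "k > Suc i" "k \<le> Suc (length u)" "col ?w k = x" "remains ?w (Suc (length u)) k"
      using IH[OF 2(2)] by blast
    \<comment> \<open>Beads are counted from 1, list entries from 0.\<close>
    have j: "col ?w (Suc i) = j"
      using i 2(1) by (simp add: col_def nth_append)
    have "blocks ?w (Suc i) k"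
      using k i 2 j by (auto simp: blocks_def)
    then have "remains ?w (Suc (length u)) (Suc i)"
      using k(4) unfolding remains_def by (rule converse_rtranclp_into_rtranclp)
    then show ?thesis
      using i j by (intro exI[of _ "Suc i"]) auto
  qed
qed

theorem theorem2p16:
  fixes \<Lambda> \<nu> :: "int multiset" and "is" :: "int list" and r m :: nat
  assumes "size \<nu> = m"
    and "is \<in> Seq \<nu>"
    and "1 \<le> r" and "r \<le> m"
  defines "R \<equiv> (cyc_klr \<Lambda> \<nu> :: 'k::field klr_free set set ring)"
  shows "nilpotency_degree R (cyc_e \<Lambda> \<nu> is) (cyc_x \<Lambda> \<nu> r is) \<le> antigravity_bound \<Lambda> is r \<and>
         corner_pow R (cyc_e \<Lambda> \<nu> is) (cyc_x \<Lambda> \<nu> r is) (antigravity_bound \<Lambda> is r) = \<zero>\<^bsub>R\<^esub>"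
proof -
  interpret klr_relations "E \<Lambda> \<nu> :: _ \<Rightarrow> 'k cyc_family" "total_dot \<Lambda> \<nu>" "total_crossing \<Lambda> \<nu>" "count \<Lambda>"
    by (rule klr_relations)
  obtain k where r: "r = Suc k" and k: "k < size \<nu>"
    using assms(1,3,4) by (cases r) auto
  let ?N = "antigravity_bound \<Lambda> is r"
  have len: "k < length is"
    using k length_Seq[OF assms(2)] by simp
  \<comment> \<open>The word is cut at the anchor, bead \<open>r = Suc k\<close>, which is list
    entry \<open>k\<close>.\<close>
  define u c t where "u = take k is" and "c = is ! k" and "t = drop (Suc k) is"
  have split: "is = u @ c # t" and u: "length u = k"
    using len by (auto simp: u_def c_def t_def id_take_nth_drop)
  have "trapped u {c} \<subseteq> antigravity_supp is r"
    using trapped_antigravity[of _ 0 u c t] by (fastforce simp: antigravity_supp_def split u r)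
  then have "cost u c \<le> ?N"
    unfolding cost_def antigravity_bound_def
    by (intro sum_mono2) (auto simp: finite_antigravity_supp)
  then have "vanishes u c ?N"
    using cost_bounds_all[of u c] vanishes_mono by (simp add: cost_bounds_def)
  then have "total_dot \<Lambda> \<nu> k ^ ?N * E \<Lambda> \<nu> is = (0 :: 'k cyc_family)"
    by (simp add: vanishes_def u split)
  then have "single \<Lambda> \<nu> (corner_pow R (cyc_e \<Lambda> \<nu> is) (cyc_x \<Lambda> \<nu> r is) ?N) = 0"
    by (simp add: E_power_corner[OF assms(2) k] R_def r)
  \<comment> \<open>\<open>single\<close> reflects 0 only on the carrier, since it sends everything
    outside to 0.\<close>
  moreover have "corner_pow R (cyc_e \<Lambda> \<nu> is) (cyc_x \<Lambda> \<nu> r is) ?N \<in> carrier R"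
  proof -
    have "cyc_x \<Lambda> \<nu> r is \<in> carrier R" "cyc_e \<Lambda> \<nu> is \<in> carrier R"
      unfolding R_def cyc_x_def cyc_e_def
      by (rule ring_hom_closed[OF cyc_hom]; use klr_x_carrier klr_e_carrier assms in auto)+
    then show ?thesis
      by (simp add: corner_pow_def R_def Group.monoid.nat_pow_closed[OF ring.is_monoid[OF ring_cyc_klr]])
  qed
  ultimately have 0: "corner_pow R (cyc_e \<Lambda> \<nu> is) (cyc_x \<Lambda> \<nu> r is) ?N = \<zero>\<^bsub>R\<^esub>"
    by (simp add: single_eq_0_iff R_def)
  then show ?thesis
    unfolding nilpotency_degree_def by (auto intro: Least_le)
qed

end
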